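(* Let $\ell>0$ and let $f\in W^{1,2}(0,\ell)$ be complex-valued with $f(x)\neq0$ for all $x\in[0,\ell]$ and $f(0)=1$. Then: (i) $\widehat{\mathbf{T}}_fv=\frac1f\mathbf{T}_fv$ for all $v\in W^{1,2}(-\ell,\ell)$. (ii) For every $x\in(0,\ell]$, $\widehat{K}_f(x,\cdot)\in W^{1,2}(-x,x)$, and $\dfrac{\partial\widehat{K}_f(x,t)}{\partial t}=\dfrac{1}{f(x)}K_f(x,t)$ a.e. in $\mathcal{T}_\ell$. (iii) The kernel $\widehat{K}_f$ satisfies the Goursat conditions $\widehat{K}_f(x,x)=1-\dfrac1{f(x)}$ and $\widehat{K}_f(x,-x)=0$.
   Context: All functions are complex-valued. $\mathcal{T}_\ell=\{(x,t): 0\le x\le\ell,\ |t|\le x\}$. $\mathbf{D}_f y:=f(y/f)'=y'-\frac{f'}{f}y$, $\mathbf{D}_{\frac1f}y:=\frac1f(fy)'=y'+\frac{f'}{f}y$. $\mathbf{S}_f$ is the Schrödinger operator $-y''+q_fy$ on $(0,\ell)$ with distributional potential $q_f=f''/f\in W^{-1,2}(0,\ell)$; its domain is $\mathscr{D}_2(\mathbf{S}_f)=\{y\in W^{1,2}(0,\ell):\mathbf{D}_fy\in W^{1,2}(0,\ell)\}$ and there $\mathbf{S}_fy=-\mathbf{D}_{\frac1f}\mathbf{D}_fy\in L^2(0,\ell)$. For $\rho\in\mathbb{C}$, $e_f(\rho,\cdot)\in\mathscr{D}_2(\mathbf{S}_f)$ is the unique solution of $\mathbf{S}_fy=\rho^2y$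 with $y(0)=1$, $\mathbf{D}_fy(0)=i\rho$. $K_f\in L^2(\mathcal{T}_\ell)$ is the kernel with $K_f(x,\cdot)\in L^2(-x,x)$ for every $x\in(0,\ell]$ and $e_f(\rho,x)=e^{i\rho x}+\int_{-x}^xK_f(x,t)e^{i\rho t}dt$ for all $\rho\in\mathbb{C}$, $x\in(0,\ell]$ (it exists and is unique up to null sets); $\mathbf{T}_fy(x)=y(x)+\int_{-x}^xK_f(x,t)y(t)\,dt$, $y\in L^2(-\ell,\ell)$. The impedance operator is $\mathbf{L}_fv=-\frac1{f^2}(f^2v')'$, $v\in W^{2,2}(0,\ell)$. For $\rho\in\mathbb{C}$, $\widehat{e}_f(\rho,\cdot)\in W^{2,2}(0,\ell)$ is the solution of $\mathbf{L}_fv=\rho^2v$ with $v(0)=1$, $v'(0)=i\rho$. $\widehat{K}_f\in L^2(\mathcal{T}_\ell)$ is the kernel with $\widehat K_f(x,\cdot)\in L^2(-x,x)$ and $\widehat{e}_f(\rho,x)=e^{i\rho x}-i\rho\int_{-x}^x\widehat{K}_f(x,t)e^{i\rho t}dt$ for all $\rho\in\mathbb{C}$, $x\in(0,\ell]$ (its existence is known), and $\widehat{\mathbf{T}}_fv(x)=v(x)-\int_{-x}^x\widehat{K}_f(x,t)v'(t)\,dt$ for $v\in W^{1,2}(-\ell,\ell)$. In (iii), $\widehat K_f(x,\pm x)$ are the endpoint values of the continuous representative of $\widehat K_f(x,\cdot)\in W^{1,2}(-x,x)$, $x\in(0,\ell]$. *)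

theory Defs
  imports "HOL-Analysis.Analysis"
begin

text \<open>Elements of \<open>L\<^sup>2\<close> and of Sobolev spaces are represented by functions; membership is insensitive
  to changes on null sets.\<close>

definition L2 :: "'a::euclidean_space set \<Rightarrow> ('a \<Rightarrow> complex) set" where
  "L2 S = {u. u \<in> borel_measurable (lebesgue_on S) \<and>
              integrable (lebesgue_on S) (\<lambda>x. (norm (u x))\<^sup>2)}"

text \<open>As usual in one dimension, \<open>C\<^sup>1\<close> test functions with compact support are used; by mollification they
  yield the same weak derivatives as smooth ones.\<close>

definition test_functions :: "real \<Rightarrow> real \<Rightarrow> (real \<Rightarrow> complex) set" where
  "test_functions a b = {\<phi>. \<phi> C1_differentiable_on UNIV \<and>
     compact (closure {x. \<phi> x \<noteq> 0}) \<and> closure {x. \<phi> x \<noteq> 0} \<subseteq> {a<..<b}}"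

definition locally_integrable :: "real \<Rightarrow> real \<Rightarrow> (real \<Rightarrow> complex) \<Rightarrow> bool" where
  "locally_integrable a b u \<longleftrightarrow>
     (\<forall>c d. {c..d} \<subseteq> {a<..<b} \<longrightarrow> set_integrable lebesgue {c..d} u)"

text \<open>Local integrability has to be demanded explicitly, since the Bochner integral of a
  non-integrable function is 0.\<close>

definition has_weak_deriv :: "real \<Rightarrow> real \<Rightarrow> (real \<Rightarrow> complex) \<Rightarrow> (real \<Rightarrow> complex) \<Rightarrow> bool" where
  "has_weak_deriv a b u g \<longleftrightarrow> locally_integrable a b u \<and> locally_integrable a b g \<and>
     (\<forall>\<phi>\<in>test_functions a b.
        (LINT x|lebesgue_on {a<..<b}. u x * vector_derivative \<phi> (at x)) =
        - (LINT x|lebesgue_on {a<..<b}. g x * \<phi> x))"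

text \<open>Some version of the weak derivative. Only properties that do not depend on the version
  may be used: a.e. equalities in the variable of differentiation, integrals, memberships and
  continuous representatives.\<close>

definition wderiv :: "real \<Rightarrow> real \<Rightarrow> (real \<Rightarrow> complex) \<Rightarrow> real \<Rightarrow> complex" where
  "wderiv a b u = (SOME g. has_weak_deriv a b u g)"

definition W12 :: "real \<Rightarrow> real \<Rightarrow> (real \<Rightarrow> complex) set" where
  "W12 a b = {u \<in> L2 {a<..<b}. \<exists>g\<in>L2 {a<..<b}. has_weak_deriv a b u g}"

definition W22 :: "real \<Rightarrow> real \<Rightarrow> (real \<Rightarrow> complex) set" where
  "W22 a b = {u \<in> L2 {a<..<b}. \<exists>g\<in>W12 a b. has_weak_deriv a b u g}"

text \<open>The continuous representative on the closed interval; its values on \<open>{a..b}\<close> are unique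
  if \<open>a < b\<close>.\<close>

definition cont_rep :: "real \<Rightarrow> real \<Rightarrow> (real \<Rightarrow> complex) \<Rightarrow> real \<Rightarrow> complex" where
  "cont_rep a b u = (SOME c. continuous_on {a..b} c \<and> (AE x in lebesgue_on {a<..<b}. c x = u x))"

text \<open>By the product rule, \<open>Dop l f y = y' - f'/f * y\<close> and \<open>Dop_inv l f y = y' + f'/f * y\<close>.\<close>

definition Dop :: "real \<Rightarrow> (real \<Rightarrow> complex) \<Rightarrow> (real \<Rightarrow> complex) \<Rightarrow> real \<Rightarrow> complex" where
  "Dop l f y = (\<lambda>x. f x * wderiv 0 l (\<lambda>s. y s / f s) x)"

definition Dop_inv :: "real \<Rightarrow> (real \<Rightarrow> complex) \<Rightarrow> (real \<Rightarrow> complex) \<Rightarrow> real \<Rightarrow> complex" where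
  "Dop_inv l f y = (\<lambda>x. 1 / f x * wderiv 0 l (\<lambda>s. f s * y s) x)"

definition schroedinger_dom :: "real \<Rightarrow> (real \<Rightarrow> complex) \<Rightarrow> (real \<Rightarrow> complex) set" where
  "schroedinger_dom l f = {y \<in> W12 0 l. Dop l f y \<in> W12 0 l}"

text \<open>The action of \<open>- y'' + (f''/f) y\<close>, with the distributional potential \<open>f''/f\<close>, on the domain above.\<close>

definition schroedinger :: "real \<Rightarrow> (real \<Rightarrow> complex) \<Rightarrow> (real \<Rightarrow> complex) \<Rightarrow> real \<Rightarrow> complex" where
  "schroedinger l f y = (\<lambda>x. - Dop_inv l f (Dop l f y) x)"

definition impedance :: "real \<Rightarrow> (real \<Rightarrow> complex) \<Rightarrow> (real \<Rightarrow> complex) \<Rightarrow> real \<Rightarrow> complex" where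
  "impedance l f v = (\<lambda>x. - (1 / (f x)\<^sup>2) * wderiv 0 l (\<lambda>s. (f s)\<^sup>2 * wderiv 0 l v s) x)"

text \<open>Solutions are taken to be the continuous representatives of their classes.\<close>

definition schroedinger_exp :: "real \<Rightarrow> (real \<Rightarrow> complex) \<Rightarrow> complex \<Rightarrow> (real \<Rightarrow> complex) \<Rightarrow> bool" where
  "schroedinger_exp l f \<rho> y \<longleftrightarrow>
     y \<in> schroedinger_dom l f \<and> continuous_on {0..l} y \<and>
     (AE x in lebesgue_on {0<..<l}. schroedinger l f y x = \<rho>\<^sup>2 * y x) \<and>
     y 0 = 1 \<and> cont_rep 0 l (Dop l f y) 0 = \<i> * \<rho>"

definition impedance_exp :: "real \<Rightarrow> (real \<Rightarrow> complex) \<Rightarrow> complex \<Rightarrow> (real \<Rightarrow> complex) \<Rightarrow> bool" where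
  "impedance_exp l f \<rho> v \<longleftrightarrow>
     v \<in> W22 0 l \<and> continuous_on {0..l} v \<and>
     (AE x in lebesgue_on {0<..<l}. impedance l f v x = \<rho>\<^sup>2 * v x) \<and>
     v 0 = 1 \<and> cont_rep 0 l (wderiv 0 l v) 0 = \<i> * \<rho>"

definition tri_dom :: "real \<Rightarrow> (real \<times> real) set" where
  "tri_dom l = {(x, t). 0 \<le> x \<and> x \<le> l \<and> \<bar>t\<bar> \<le> x}"

definition L2_kernel :: "real \<Rightarrow> (real \<Rightarrow> real \<Rightarrow> complex) \<Rightarrow> bool" where
  "L2_kernel l K \<longleftrightarrow> (\<lambda>(x, t). K x t) \<in> L2 (tri_dom l) \<and> (\<forall>x\<in>{0<..l}. K x \<in> L2 {-x<..<x})"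

definition schroedinger_kernel ::
  "real \<Rightarrow> (complex \<Rightarrow> real \<Rightarrow> complex) \<Rightarrow> (real \<Rightarrow> real \<Rightarrow> complex) \<Rightarrow> bool" where
  "schroedinger_kernel l e K \<longleftrightarrow> L2_kernel l K \<and>
     (\<forall>\<rho>. \<forall>x\<in>{0<..l}. e \<rho> x = exp (\<i> * \<rho> * of_real x) +
        (LINT t|lebesgue_on {-x<..<x}. K x t * exp (\<i> * \<rho> * of_real t)))"

definition impedance_kernel ::
  "real \<Rightarrow> (complex \<Rightarrow> real \<Rightarrow> complex) \<Rightarrow> (real \<Rightarrow> real \<Rightarrow> complex) \<Rightarrow> bool" where
  "impedance_kernel l e K \<longleftrightarrow> L2_kernel l K \<and>
     (\<forall>\<rho>. \<forall>x\<in>{0<..l}. e \<rho> x = exp (\<i> * \<rho> * of_real x) -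
        \<i> * \<rho> * (LINT t|lebesgue_on {-x<..<x}. K x t * exp (\<i> * \<rho> * of_real t)))"

definition T_op :: "(real \<Rightarrow> real \<Rightarrow> complex) \<Rightarrow> (real \<Rightarrow> complex) \<Rightarrow> real \<Rightarrow> complex" where
  "T_op K y x = y x + (LINT t|lebesgue_on {-x<..<x}. K x t * y t)"

definition T_hat_op :: "real \<Rightarrow> (real \<Rightarrow> real \<Rightarrow> complex) \<Rightarrow> (real \<Rightarrow> complex) \<Rightarrow> real \<Rightarrow> complex" where
  "T_hat_op l K v x = v x - (LINT t|lebesgue_on {-x<..<x}. K x t * wderiv (-l) l v t)"

text \<open>\<open>G\<close> is a version of the weak partial derivative \<open>\<partial>K/\<partial>t\<close>. Joint measurability is part of the
  definition: versions chosen independently for each \<open>x\<close> need not be measurable on the triangle,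
  and an a.e. statement there would be meaningless for them.\<close>

definition has_weak_dt :: "real \<Rightarrow> (real \<Rightarrow> real \<Rightarrow> complex) \<Rightarrow> (real \<Rightarrow> real \<Rightarrow> complex) \<Rightarrow> bool" where
  "has_weak_dt l K G \<longleftrightarrow> (\<lambda>(x, t). G x t) \<in> borel_measurable (lebesgue_on (tri_dom l)) \<and>
     (\<forall>x\<in>{0<..l}. has_weak_deriv (-x) x (K x) (G x))"

end

(* Writing v = y / f turns the Schroedinger equation into the impedance equation, so e_f = f * e_hat_f
   by uniqueness for the first-order system u' = w / f^2, w' = - rho^2 f^2 u.  For fixed x let H be the
   primitive of K_f(x, .) / f(x) on [-x, x] vanishing at -x.  Since e_hat_f(0, x) = 1, taking rho = 0
   gives H(x) = 1 - 1 / f(x).  Integrating by parts in the representation of e_f and comparing with that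
   of e_hat_f, the integral of (H - K_hat_f(x, .)) exp(i rho t) over (-x, x) vanishes for rho <> 0; for
   rho = -i n with n >= 1 these are the moments against exp(n t), and they force K_hat_f(x, .) = H a.e.
   All three claims are then statements about the primitive H. *)
theory Submission
  imports Defs
begin

subsection \<open>Absolutely continuous functions\<close>

text \<open>With \<open>f\<close> only in \<open>W12\<close>, \<open>f''\<close> is no function, and
  derivatives exist merely up to null sets. All calculus therefore runs through functions given as
  integrals: \<open>primitive_on\<close> carries a chosen derivative \<open>g\<close> that may be
  altered on a null set, and no product or quotient is ever differentiated pointwise. Weak
  derivatives are converted to this form by the du Bois-Reymond lemma; after that, integration by
  parts is the product rule. The factor \<open>\<i> * \<rho>\<close> before the integral of
  \<open>K_hat\<close> erases all information on \<open>K_hat\<close> at \<open>\<rho> = 0\<close>.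
  Every identity for fixed \<open>x\<close> has an exceptional null set depending on
  \<open>x\<close>. Turning this into a statement almost everywhere on the triangle takes Tonelli
  and hence joint measurability, which is inherited from \<open>K\<close>; the primitives, chosen
  separately for each \<open>x\<close>, could not provide it.\<close>

definition primitive_on :: "real \<Rightarrow> real \<Rightarrow> (real \<Rightarrow> complex) \<Rightarrow> (real \<Rightarrow> complex) \<Rightarrow> bool" where
  "primitive_on a b u g \<longleftrightarrow> g absolutely_integrable_on {a..b} \<and>
     (\<forall>x\<in>{a..b}. u x - u a = integral {a..x} g)"

lemma primitive_on_integrable:
  assumes "primitive_on a b u g"
  shows "g absolutely_integrable_on {a..b}" "g integrable_on {a..b}"
  using assms set_lebesgue_integral_eq_integral(1) by (auto simp: primitive_on_def)

lemma primitive_on_diff: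
  assumes "primitive_on a b u g" "a \<le> x" "x \<le> y" "y \<le> b"
  shows "u y - u x = integral {x..y} g"
proof -
  have "g integrable_on {a..y}"
    using primitive_on_integrable(2)[OF assms(1)] assms(4) integrable_on_subinterval by fastforce
  then have "integral {a..x} g + integral {x..y} g = integral {a..y} g"
    using Henstock_Kurzweil_Integration.integral_combine[of a x y g] assms by auto
  moreover have "u x - u a = integral {a..x} g" "u y - u a = integral {a..y} g"
    using assms by (auto simp: primitive_on_def)
  ultimately show ?thesis by (simp add: algebra_simps)
qed

lemma primitive_on_continuous:
  assumes "primitive_on a b u g"
  shows "continuous_on {a..b} u"
proof -
  have "continuous_on {a..b} (\<lambda>x. u a + integral {a..x} g)"
    by (intro continuous_intros indefinite_integral_continuous_1 primitive_on_integrable(2)[OF assms])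
  then show ?thesis
  proof (rule continuous_on_eq)
    show "u a + integral {a..x} g = u x" if "x \<in> {a..b}" for x
      using primitive_on_diff[OF assms order_refl, of x] that by (auto simp: algebra_simps)
  qed
qed

lemma primitive_on_cong:
  assumes "primitive_on a b u g" "\<And>x. x \<in> {a..b} \<Longrightarrow> v x = u x"
  shows "primitive_on a b v g"
  using assms by (cases "a \<le> b") (auto simp: primitive_on_def)

lemma primitive_on_cong_AE:
  assumes "primitive_on a b u g" "negligible N" "\<And>x. x \<in> {a..b} - N \<Longrightarrow> h x = g x"
  shows "primitive_on a b u h"
proof -
  have "h absolutely_integrable_on {a..b}"
    by (rule absolutely_integrable_spike[OF _ assms(2)]) (use assms in \<open>auto simp: primitive_on_def\<close>)
  moreover have "integral {a..x} h = integral {a..x} g" if "x \<in> {a..b}" for x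
    by (rule integral_spike[OF assms(2)]) (use assms(3) that in auto)
  ultimately show ?thesis using assms(1) by (auto simp: primitive_on_def)
qed

lemma primitive_on_subinterval:
  assumes "primitive_on a b u g" "a \<le> c" "d \<le> b"
  shows "primitive_on c d u g"
  unfolding primitive_on_def
proof (intro conjI ballI)
  show "g absolutely_integrable_on {c..d}"
    using absolutely_integrable_on_subinterval[OF primitive_on_integrable(1)[OF assms(1)]] assms by auto
  show "u x - u c = integral {c..x} g" if "x \<in> {c..d}" for x
    using primitive_on_diff[OF assms(1), of c x] that assms by auto
qed

lemma primitive_on_indefinite:
  assumes "g absolutely_integrable_on {a..b}"
  shows "primitive_on a b (\<lambda>x. c + integral {a..x} g) g"
  using assms by (auto simp: primitive_on_def)

lemma primitive_on_C1:
  fixes u :: "real \<Rightarrow> complex"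
  assumes "\<And>x. x \<in> {a..b} \<Longrightarrow> (u has_vector_derivative u' x) (at x within {a..b})"
    and "continuous_on {a..b} u'"
  shows "primitive_on a b u u'"
  unfolding primitive_on_def
proof (intro conjI ballI)
  show "u' absolutely_integrable_on {a..b}"
    using assms(2) absolutely_integrable_continuous_real by blast
  show "u x - u a = integral {a..x} u'" if x: "x \<in> {a..b}" for x
  proof -
    have "(u' has_integral (u x - u a)) {a..x}"
      by (rule fundamental_theorem_of_calculus)
        (use x in \<open>auto intro!: has_vector_derivative_within_subset[OF assms(1)]\<close>)
    then show ?thesis by (simp add: integral_unique)
  qed
qed

text \<open>An additive interval function that is locally \<open>o\<close> of the integral of \<open>m\<close> vanishes; this
  replaces differentiation almost everywhere in the product and quotient rules.\<close>

lemma primitive_on_local: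
  fixes m :: "real \<Rightarrow> real"
  assumes k: "k absolutely_integrable_on {a..b}" and m: "m integrable_on {a..b}"
    and local: "\<And>x e. a \<le> x \<Longrightarrow> x \<le> b \<Longrightarrow> 0 < e \<Longrightarrow> \<exists>d>0. \<forall>p q. a \<le> p \<and> p \<le> x \<and> x \<le> q \<and> q \<le> b \<and> q - p < d
       \<longrightarrow> norm (w q - w p - integral {p..q} k) \<le> e * integral {p..q} m"
  shows "primitive_on a b w k"
  unfolding primitive_on_def
proof (intro conjI ballI k)
  fix y assume y: "y \<in> {a..b}"
  have k': "k integrable_on {p..q}" "m integrable_on {p..q}" if "a \<le> p" "q \<le> b" for p q
    using integrable_on_subinterval[OF set_lebesgue_integral_eq_integral(1)[OF k], of p q]
      integrable_on_subinterval[OF m, of p q] that by auto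
  have bound: "norm (w y - w a - integral {a..y} k) \<le> e * integral {a..y} m" if e: "0 < e" for e
  proof -
    \<comment> \<open>\<open>Bolzano\<close> spreads a property from all small intervals around each
      point to the whole interval, provided it survives concatenation; here both integrals are
      additive and the norm is subadditive. The guard \<open>a \<le> p \<and> q \<le> b\<close>
      makes \<open>P\<close> true for small intervals that stick out of \<open>{a..b}\<close>, where
      nothing is known.\<close>
    define P where "P p q \<longleftrightarrow> (a \<le> p \<and> q \<le> b \<longrightarrow>
       norm (w q - w p - integral {p..q} k) \<le> e * integral {p..q} m)" for p q
    have "a \<le> y" using y by auto
    then have "P a y"
    proof (induction rule: Bolzano)
      case (trans p q r)
      show ?case unfolding P_def
      proof
        assume pr: "a \<le> p \<and> r \<le> b"
        have "integral {p..q} k + integral {q..r} k = integral {p..r} k"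
          "integral {p..q} m + integral {q..r} m = integral {p..r} m"
          using trans pr by (auto intro!: Henstock_Kurzweil_Integration.integral_combine k')
        moreover have "norm (w r - w q - integral {q..r} k) \<le> e * integral {q..r} m"
          "norm (w q - w p - integral {p..q} k) \<le> e * integral {p..q} m"
          using trans pr by (auto simp: P_def)
        moreover have "w r - w p - (integral {p..q} k + integral {q..r} k)
          = (w q - w p - integral {p..q} k) + (w r - w q - integral {q..r} k)"
          by simp
        ultimately show "norm (w r - w p - integral {p..r} k) \<le> e * integral {p..r} m"
          by (metis (no_types, lifting) norm_triangle_mono distrib_left)
      qed
    next
      case (local x)
      then have x: "a \<le> x" "x \<le> b" using y by auto
      obtain d where "d > 0" "\<forall>p q. a \<le> p \<and> p \<le> x \<and> x \<le> q \<and> q \<le> b \<and> q - p < d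
       \<longrightarrow> norm (w q - w p - integral {p..q} k) \<le> e * integral {p..q} m"
        using assms(3)[OF x e] by blast
      then show ?case unfolding P_def by (intro exI[of _ d]) auto
    qed
    then show ?thesis using y by (auto simp: P_def)
  qed
  have "norm (w y - w a - integral {a..y} k) \<le> 0"
  proof (rule field_le_epsilon)
    fix e :: real assume e: "0 < e"
    define C where "C = \<bar>integral {a..y} m\<bar> + 1"
    have "C > 0" by (simp add: C_def)
    have "norm (w y - w a - integral {a..y} k) \<le> e / C * integral {a..y} m"
      using bound[of "e / C"] e \<open>C > 0\<close> by simp
    also have "\<dots> \<le> e / C * C"
      using e \<open>C > 0\<close> by (intro mult_left_mono) (auto simp: C_def)
    finally show "norm (w y - w a - integral {a..y} k) \<le> 0 + e" using \<open>C > 0\<close> by simp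
  qed
  then show "w y - w a = integral {a..y} k" by simp
qed

section \<open>Product and quotient rules for primitives\<close>

lemma absolutely_integrable_continuous_mult:
  fixes u g :: "real \<Rightarrow> complex"
  assumes "continuous_on {a..b} u" "g absolutely_integrable_on {a..b}"
  shows "(\<lambda>x. u x * g x) absolutely_integrable_on {a..b}"
proof (rule absolutely_integrable_bounded_measurable_product[where h = "(*)"])
  show "bilinear ((*) :: complex \<Rightarrow> complex \<Rightarrow> complex)" by (rule bilinear_times)
  show "u \<in> borel_measurable (lebesgue_on {a..b})"
    using assms(1) by (simp add: continuous_imp_measurable_on_sets_lebesgue)
  show "bounded (u ` {a..b})"
    using assms(1) by (simp add: compact_continuous_image compact_imp_bounded)
qed (use assms in auto)

lemma continuous_on_near_point:
  fixes u :: "real \<Rightarrow> complex"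
  assumes "continuous_on {a..b} u" "x \<in> {a..b}" "0 < e"
  shows "\<exists>d>0. \<forall>s t. s \<in> {a..b} \<and> t \<in> {a..b} \<and> \<bar>s - x\<bar> < d \<and> \<bar>t - x\<bar> < d \<longrightarrow> norm (u s - u t) < e"
proof -
  obtain d where d: "d > 0" "\<And>s. s \<in> {a..b} \<Longrightarrow> dist s x < d \<Longrightarrow> dist (u s) (u x) < e/2"
    using assms unfolding continuous_on_iff by (meson half_gt_zero)
  have "norm (u s - u t) < e" if "s \<in> {a..b}" "t \<in> {a..b}" "\<bar>s - x\<bar> < d" "\<bar>t - x\<bar> < d" for s t
    using d(2)[of s] d(2)[of t] that dist_triangle_half_r[of "u x" "u s" e "u t"]
    by (auto simp: dist_norm norm_minus_commute)
  then show ?thesis using d(1) by blast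
qed

text \<open>On a short interval the increment of the product is the integral of
  \<open>u q * h + v p * g\<close> with frozen coefficients. By continuity, freezing costs at most
  \<open>e * (norm (g t) + norm (h t))\<close> in the integrand, which is what
  \<open>primitive_on_local\<close> asks for.\<close>

lemma primitive_on_mult:
  assumes u: "primitive_on a b u g" and v: "primitive_on a b v h"
  shows "primitive_on a b (\<lambda>x. u x * v x) (\<lambda>x. u x * h x + v x * g x)"
proof -
  note cu = primitive_on_continuous[OF u] and cv = primitive_on_continuous[OF v]
  note ig = primitive_on_integrable[OF u] and ih = primitive_on_integrable[OF v]
  have iuh: "(\<lambda>x. u x * h x) absolutely_integrable_on {a..b}"
    and ivg: "(\<lambda>x. v x * g x) absolutely_integrable_on {a..b}"
    using absolutely_integrable_continuous_mult cu cv ig ih by auto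
  have k: "(\<lambda>x. u x * h x + v x * g x) absolutely_integrable_on {a..b}"
    using iuh ivg by (rule set_integral_add)
  have mi: "(\<lambda>x. norm (g x) + norm (h x)) integrable_on {a..b}"
    using ig(1) ih(1) by (auto intro!: integrable_add simp: absolutely_integrable_on_def)
  show ?thesis
  proof (rule primitive_on_local[OF k mi])
    fix x e :: real assume x: "a \<le> x" "x \<le> b" and e: "0 < e"
    obtain d1 where d1: "d1 > 0" "\<forall>s t. s \<in> {a..b} \<and> t \<in> {a..b} \<and> \<bar>s - x\<bar> < d1 \<and> \<bar>t - x\<bar> < d1 \<longrightarrow> norm (u s - u t) < e"
      using continuous_on_near_point[OF cu _ e] x by (meson atLeastAtMost_iff)
    obtain d2 where d2: "d2 > 0" "\<forall>s t. s \<in> {a..b} \<and> t \<in> {a..b} \<and> \<bar>s - x\<bar> < d2 \<and> \<bar>t - x\<bar> < d2 \<longrightarrow> norm (v s - v t) < e"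
      using continuous_on_near_point[OF cv _ e] x by (meson atLeastAtMost_iff)
    show "\<exists>d>0. \<forall>p q. a \<le> p \<and> p \<le> x \<and> x \<le> q \<and> q \<le> b \<and> q - p < d \<longrightarrow>
      norm (u q * v q - u p * v p - integral {p..q} (\<lambda>x. u x * h x + v x * g x))
        \<le> e * integral {p..q} (\<lambda>x. norm (g x) + norm (h x))"
    proof (rule exI[of _ "min d1 d2"], intro conjI allI impI)
      fix p q assume pq: "a \<le> p \<and> p \<le> x \<and> x \<le> q \<and> q \<le> b \<and> q - p < min d1 d2"
      then have sub: "{p..q} \<subseteq> {a..b}" by auto
      have ints: "g integrable_on {p..q}" "h integrable_on {p..q}"
        "(\<lambda>x. u x * h x + v x * g x) integrable_on {p..q}" "(\<lambda>x. norm (g x) + norm (h x)) integrable_on {p..q}"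
        using ig(2) ih(2) mi set_lebesgue_integral_eq_integral(1)[OF k] sub
          integrable_on_subinterval by blast+
      have "u q * v q - u p * v p = u q * (v q - v p) + v p * (u q - u p)"
        by (simp add: algebra_simps)
      also have "\<dots> = integral {p..q} (\<lambda>t. u q * h t) + integral {p..q} (\<lambda>t. v p * g t)"
        using primitive_on_diff[OF u, of p q] primitive_on_diff[OF v, of p q] pq by simp
      also have "\<dots> = integral {p..q} (\<lambda>t. u q * h t + v p * g t)"
        using ints by (subst integral_add) (auto intro: integrable_on_mult_right)
      finally have "u q * v q - u p * v p - integral {p..q} (\<lambda>x. u x * h x + v x * g x)
        = integral {p..q} (\<lambda>t. (u q * h t + v p * g t) - (u t * h t + v t * g t))"
        using ints by (subst integral_diff) (auto intro!: integrable_on_mult_right integrable_add)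
      also have "norm \<dots> \<le> integral {p..q} (\<lambda>t. e * (norm (g t) + norm (h t)))"
      proof (rule integral_norm_bound_integral)
        fix t assume t: "t \<in> {p..q}"
        have "norm (u q - u t) < e" using d1(2) t pq by auto
        moreover have "norm (v p - v t) < e" using d2(2) t pq by auto
        moreover have "(u q * h t + v p * g t) - (u t * h t + v t * g t) = (v p - v t) * g t + (u q - u t) * h t"
          by (simp add: algebra_simps)
        ultimately show "norm ((u q * h t + v p * g t) - (u t * h t + v t * g t)) \<le> e * (norm (g t) + norm (h t))"
          unfolding distrib_left
          by (auto intro!: norm_triangle_le add_mono mult_right_mono simp: norm_mult)
      qed (use ints in \<open>auto intro!: integrable_diff integrable_add integrable_on_mult_right\<close>)
      finally show "norm (u q * v q - u p * v p - integral {p..q} (\<lambda>x. u x * h x + v x * g x))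
        \<le> e * integral {p..q} (\<lambda>x. norm (g x) + norm (h x))"
        by simp
    qed (use d1 d2 in auto)
  qed
qed

text \<open>Same freezing argument: the increment of \<open>1 / u\<close> is exactly the increment
  of \<open>u\<close> times \<open>- 1 / (u p * u q)\<close>, and this factor is close to
  \<open>- 1 / (u t)\<^sup>2\<close> because \<open>1 / u\<close> is continuous and bounded on the
  compact interval.\<close>

lemma primitive_on_inverse:
  assumes u: "primitive_on a b u g" and nz: "\<And>x. x \<in> {a..b} \<Longrightarrow> u x \<noteq> 0"
  shows "primitive_on a b (\<lambda>x. 1 / u x) (\<lambda>x. - (1 / (u x)\<^sup>2) * g x)"
proof -
  note cu = primitive_on_continuous[OF u] and ig = primitive_on_integrable[OF u]
  have ci: "continuous_on {a..b} (\<lambda>x. 1 / u x)" using cu nz by (auto intro!: continuous_intros)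
  have "continuous_on {a..b} (\<lambda>x. - (1 / (u x)\<^sup>2))" using cu nz by (auto intro!: continuous_intros)
  then have k: "(\<lambda>x. - (1 / (u x)\<^sup>2) * g x) absolutely_integrable_on {a..b}"
    using absolutely_integrable_continuous_mult ig by blast
  have "bounded ((\<lambda>x. 1 / u x) ` {a..b})"
    using ci by (simp add: compact_continuous_image compact_imp_bounded)
  then obtain M where M: "M > 0" "\<And>x. x \<in> {a..b} \<Longrightarrow> norm (1 / u x) \<le> M"
    unfolding bounded_pos by auto
  have mi: "(\<lambda>x. norm (g x)) integrable_on {a..b}"
    using ig(1) by (auto simp: absolutely_integrable_on_def)
  show ?thesis
  proof (rule primitive_on_local[OF k mi])
    fix x e :: real assume x: "a \<le> x" "x \<le> b" and e: "0 < e"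
    define e' where "e' = e / (2 * M)"
    have e': "e' > 0" using e M by (simp add: e'_def)
    obtain d where d: "d > 0" "\<forall>s t. s \<in> {a..b} \<and> t \<in> {a..b} \<and> \<bar>s - x\<bar> < d \<and> \<bar>t - x\<bar> < d \<longrightarrow> norm (1 / u s - 1 / u t) < e'"
      using continuous_on_near_point[OF ci _ e'] x by (meson atLeastAtMost_iff)
    show "\<exists>d>0. \<forall>p q. a \<le> p \<and> p \<le> x \<and> x \<le> q \<and> q \<le> b \<and> q - p < d \<longrightarrow>
      norm (1 / u q - 1 / u p - integral {p..q} (\<lambda>x. - (1 / (u x)\<^sup>2) * g x))
        \<le> e * integral {p..q} (\<lambda>x. norm (g x))"
    proof (rule exI[of _ d], intro conjI allI impI)
      fix p q assume pq: "a \<le> p \<and> p \<le> x \<and> x \<le> q \<and> q \<le> b \<and> q - p < d"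
      then have sub: "{p..q} \<subseteq> {a..b}" by auto
      have ints: "g integrable_on {p..q}" "(\<lambda>x. norm (g x)) integrable_on {p..q}"
        "(\<lambda>x. - (1 / (u x)\<^sup>2) * g x) integrable_on {p..q}"
        using ig(2) mi set_lebesgue_integral_eq_integral(1)[OF k] sub
          integrable_on_subinterval by blast+
      have "1 / u q - 1 / u p = - (1 / u p * (1 / u q)) * (u q - u p)"
        using nz[of p] nz[of q] pq by (auto simp: field_simps)
      also have "\<dots> = integral {p..q} (\<lambda>t. - (1 / u p * (1 / u q)) * g t)"
        using primitive_on_diff[OF u, of p q] pq by simp
      finally have "1 / u q - 1 / u p - integral {p..q} (\<lambda>x. - (1 / (u x)\<^sup>2) * g x)
        = integral {p..q} (\<lambda>t. - (1 / u p * (1 / u q)) * g t - (- (1 / (u t)\<^sup>2) * g t))"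
        by (simp only:, subst integral_diff) (intro refl integrable_on_mult_right ints)+
      also have "norm \<dots> \<le> integral {p..q} (\<lambda>t. e * norm (g t))"
      proof (rule integral_norm_bound_integral)
        fix t assume t: "t \<in> {p..q}"
        have 1: "norm (1 / u t - 1 / u q) \<le> e'" using d(2) t pq by (auto intro!: less_imp_le)
        have 2: "norm (1 / u t - 1 / u p) \<le> e'" using d(2) t pq by (auto intro!: less_imp_le)
        have "- (1 / u p * (1 / u q)) * g t - (- (1 / (u t)\<^sup>2) * g t)
          = (1 / u t * (1 / u t - 1 / u q) + 1 / u q * (1 / u t - 1 / u p)) * g t"
          by (simp add: algebra_simps power2_eq_square)
        also have "norm \<dots> \<le> (M * e' + M * e') * norm (g t)"
        proof -
          have "norm (1 / u t * (1 / u t - 1 / u q)) \<le> M * e'" "norm (1 / u q * (1 / u t - 1 / u p)) \<le> M * e'"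
            unfolding norm_mult using 1 2 M(1) t pq by (auto intro!: mult_mono M(2))
          then show ?thesis
            unfolding norm_mult[of _ "g t"] by (intro mult_right_mono norm_triangle_le add_mono) auto
        qed
        also have "M * e' + M * e' = e" using M by (simp add: e'_def)
        finally show "norm (- (1 / u p * (1 / u q)) * g t - (- (1 / (u t)\<^sup>2) * g t)) \<le> e * norm (g t)" .
      qed (intro integrable_diff integrable_on_mult_right ints)+
      finally show "norm (1 / u q - 1 / u p - integral {p..q} (\<lambda>x. - (1 / (u x)\<^sup>2) * g x))
        \<le> e * integral {p..q} (\<lambda>x. norm (g x))"
        by simp
    qed (use d in auto)
  qed
qed

subsection \<open>Weak derivatives\<close>

lemma AE_lebesgue_on_iff_negligible:
  assumes "S \<in> sets lebesgue"
  shows "(AE x in lebesgue_on S. P x) \<longleftrightarrow> negligible {x \<in> S. \<not> P x}"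
proof -
  have "(AE x in lebesgue_on S. P x) \<longleftrightarrow> (AE x in lebesgue. x \<in> S \<longrightarrow> P x)"
    using assms by (simp add: AE_restrict_space_iff)
  also have "\<dots> \<longleftrightarrow> negligible {x \<in> S. \<not> P x}"
    unfolding eventually_ae_filter_negligible by (auto intro: negligible_subset)
  finally show ?thesis .
qed

text \<open>Completeness of Lebesgue measure transfers measurability between functions equal almost
  everywhere. If one function is not measurable, neither is the other, and both integrals take the
  default value 0. This allows versions of weak derivatives to be exchanged without checking
  measurability.\<close>

lemma LINT_cong_AE_lebesgue_on:
  fixes f g :: "'a::euclidean_space \<Rightarrow> 'b::euclidean_space"
  assumes S: "S \<in> sets lebesgue" and ae: "AE x in lebesgue_on S. f x = g x"
  shows "(LINT x|lebesgue_on S. f x) = (LINT x|lebesgue_on S. g x)"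
proof -
  have *: "v \<in> borel_measurable (lebesgue_on S)"
    if "u \<in> borel_measurable (lebesgue_on S)" "AE x in lebesgue_on S. u x = v x" for u v :: "'a \<Rightarrow> 'b"
  proof -
    have N: "negligible {x \<in> S. \<not> u x = v x}"
      using that(2) S by (simp add: AE_lebesgue_on_iff_negligible)
    have "v measurable_on S"
      by (rule measurable_on_spike[where f = u, OF _ N])
        (use that(1) S in \<open>auto simp: measurable_on_iff_borel_measurable\<close>)
    then show ?thesis using S by (simp add: measurable_on_iff_borel_measurable)
  qed
  have ae': "AE x in lebesgue_on S. g x = f x" using ae by auto
  show ?thesis
  proof (cases "f \<in> borel_measurable (lebesgue_on S)")
    case True
    show ?thesis by (rule integral_cong_AE[OF True *[OF True ae] ae])
  next
    case False
    then have "g \<notin> borel_measurable (lebesgue_on S)" using *[OF _ ae'] by blast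
    with False have "\<not> integrable (lebesgue_on S) f" "\<not> integrable (lebesgue_on S) g" by auto
    then show ?thesis by (simp add: not_integrable_integral_eq)
  qed
qed

lemma LINT_eq_integral_Icc:
  fixes f :: "real \<Rightarrow> complex"
  assumes "f absolutely_integrable_on {a..b}"
  shows "(LINT x|lebesgue_on {a<..<b}. f x) = integral {a..b} f"
proof -
  have "f absolutely_integrable_on {a<..<b}"
    using assms absolutely_integrable_on_Icc_iff_Ioo by blast
  then have "integrable (lebesgue_on {a<..<b}) f"
    by (rule absolutely_integrable_imp_integrable) auto
  then have "(LINT x|lebesgue_on {a<..<b}. f x) = integral {a<..<b} f"
    by (rule lebesgue_integral_eq_integral) auto
  then show ?thesis by (simp add: integral_open_interval_real)
qed

text \<open>The interval is bounded, so \<open>1 + (norm (u x))\<^sup>2\<close> is an integrable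
  majorant.\<close>

lemma L2_absolutely_integrable:
  assumes "u \<in> L2 {a<..<b::real}"
  shows "u absolutely_integrable_on {a..b}"
proof -
  have "u absolutely_integrable_on {a<..<b}"
  proof (rule measurable_bounded_by_integrable_imp_absolutely_integrable)
    show "(\<lambda>x. 1 + (norm (u x))\<^sup>2) integrable_on {a<..<b}"
    proof (rule integrable_add)
      show "(\<lambda>x. 1::real) integrable_on {a<..<b}" by (rule integrable_on_const) auto
      show "(\<lambda>x. (norm (u x))\<^sup>2) integrable_on {a<..<b}"
        by (rule integrable_on_lebesgue_on) (use assms in \<open>auto simp: L2_def\<close>)
    qed
    show "norm (u x) \<le> 1 + (norm (u x))\<^sup>2" for x
    proof -
      have "0 \<le> (norm (u x) - 1)\<^sup>2" by simp
      then have "2 * norm (u x) \<le> 1 + (norm (u x))\<^sup>2" by (simp add: power2_diff)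
      then show ?thesis using norm_ge_zero[of "u x"] by linarith
    qed
  qed (use assms in \<open>auto simp: L2_def\<close>)
  then show ?thesis using absolutely_integrable_on_Icc_iff_Ioo by blast
qed

lemma absolutely_integrable_locally_integrable:
  assumes "u absolutely_integrable_on {a..b}"
  shows "locally_integrable a b u"
  unfolding locally_integrable_def
  using absolutely_integrable_on_subinterval[OF assms] greaterThanLessThan_subseteq_atLeastAtMost_iff
  by (meson atLeastAtMost_iff greaterThanLessThan_iff less_imp_le subset_iff)

lemma locally_integrable_diff:
  assumes "locally_integrable a b u" "locally_integrable a b v"
  shows "locally_integrable a b (\<lambda>x. u x - v x)"
  using assms unfolding locally_integrable_def by (auto intro!: set_integral_diff)

lemma locally_integrable_const: "locally_integrable a b (\<lambda>x. c)"
  unfolding locally_integrable_def by auto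

lemma locally_integrable_Icc:
  assumes "locally_integrable a b u" "a < c" "d < b"
  shows "u absolutely_integrable_on {c..d}"
  using assms(1)[unfolded locally_integrable_def, rule_format, of c d] assms(2,3) by fastforce

lemma continuous_AE_eq:
  fixes u v :: "real \<Rightarrow> complex"
  assumes "a < b" "continuous_on {a..b} u" "continuous_on {a..b} v"
    and ae: "AE x in lebesgue_on {a<..<b}. u x = v x" and x: "x \<in> {a..b}"
  shows "u x = v x"
proof -
  have N: "negligible ({x \<in> {a<..<b}. u x \<noteq> v x} \<union> {a, b})"
    using ae by (auto simp: AE_lebesgue_on_iff_negligible intro: negligible_insert[THEN iffD2])
  have "integral {a..b} (\<lambda>x. norm (u x - v x)) = integral {a..b} (\<lambda>x. 0)"
    by (rule integral_spike[OF N]) auto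
  moreover have "continuous_on {a..b} (\<lambda>x. norm (u x - v x))"
    using assms by (intro continuous_intros)
  ultimately have "\<forall>x\<in>{a..b}. norm (u x - v x) = 0"
    using integral_eq_0_iff[of a b "\<lambda>x. norm (u x - v x)"] assms(1) by simp
  then show ?thesis using x by auto
qed

section \<open>Bump functions and the fundamental lemma of the calculus of variations\<close>

text \<open>The support lies in a compact interval, so that integrals against merely locally
  integrable functions reduce to \<open>{c..d}\<close>. No sign is required: antiderivatives of
  mean-zero functions must qualify as well.\<close>

definition bump_fun :: "real \<Rightarrow> real \<Rightarrow> (real \<Rightarrow> real) \<Rightarrow> (real \<Rightarrow> real) \<Rightarrow> bool" where
  "bump_fun c d \<phi> \<phi>' \<longleftrightarrow> (\<forall>x. (\<phi> has_real_derivative \<phi>' x) (at x)) \<and> continuous_on UNIV \<phi>' \<and>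
     (\<forall>x. x \<notin> {c<..<d} \<longrightarrow> \<phi> x = 0 \<and> \<phi>' x = 0)"

lemma bump_fun_continuous:
  assumes "bump_fun c d \<phi> \<phi>'"
  shows "continuous_on S \<phi>" "continuous_on S \<phi>'"
proof -
  show "continuous_on S \<phi>"
    using assms DERIV_isCont by (auto simp: bump_fun_def intro!: continuous_at_imp_continuous_on)
  show "continuous_on S \<phi>'"
    using assms continuous_on_subset by (auto simp: bump_fun_def)
qed

lemma DERIV_pos_part_square:
  "((\<lambda>s::real. (max 0 s)\<^sup>2) has_real_derivative 2 * max 0 s) (at s)"
proof (cases s "0::real" rule: linorder_cases)
  case less
  have "((\<lambda>s::real. 0) has_real_derivative 2 * max 0 s) (at s)" using less by (simp add: max_def)
  then show ?thesis
    by (rule has_field_derivative_transform_within_open[of _ _ _ "{..<0}"]) (use less in auto)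
next
  case equal
  have "((\<lambda>h::real. (max 0 h)\<^sup>2 / h) \<longlongrightarrow> 0) (at 0)"
  proof (rule Lim_null_comparison[of _ "\<lambda>h. \<bar>h\<bar>"])
    show "\<forall>\<^sub>F h in at 0. norm ((max 0 h)\<^sup>2 / h :: real) \<le> \<bar>h\<bar>"
      by (rule always_eventually) (auto simp: max_def power2_eq_square)
    show "((\<lambda>h::real. \<bar>h\<bar>) \<longlongrightarrow> 0) (at 0)" using tendsto_rabs[OF tendsto_ident_at, of "0::real"] by simp
  qed
  then show ?thesis using equal by (simp add: DERIV_def)
next
  case greater
  have "((\<lambda>s::real. s\<^sup>2) has_real_derivative 2 * max 0 s) (at s)"
    using greater by (auto intro!: derivative_eq_intros)
  then show ?thesis
    by (rule has_field_derivative_transform_within_open[of _ _ _ "{0<..}"]) (use greater in auto)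
qed

lemma bump_sequence:
  fixes c d :: real
  obtains \<phi> \<phi>' :: "nat \<Rightarrow> real \<Rightarrow> real"
  where "\<And>n. bump_fun c d (\<phi> n) (\<phi>' n)" "\<And>n x. 0 \<le> \<phi> n x" "\<And>n x. \<phi> n x \<le> 1"
    "\<And>n x. x \<in> {c<..<d} \<Longrightarrow> 0 < \<phi> n x" "\<And>x. x \<in> {c<..<d} \<Longrightarrow> (\<lambda>n. \<phi> n x) \<longlonglongrightarrow> 1"
proof -
  \<comment> \<open>\<open>r\<close> is positive exactly on the open interval, and the squares make
    it continuously differentiable at both ends. The quotients \<open>r x / (k n + r x)\<close> lie
    between 0 and 1 and tend to 1 wherever \<open>r\<close> is positive; \<open>k n > 0\<close>
    keeps the denominators away from zero.\<close>
  define r where "r x = (max 0 (x - c))\<^sup>2 * (max 0 (d - x))\<^sup>2" for x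
  define r' where "r' x = 2 * max 0 (x - c) * (max 0 (d - x))\<^sup>2 - (max 0 (x - c))\<^sup>2 * (2 * max 0 (d - x))" for x
  define k where "k n = inverse (real (Suc n))" for n
  have kpos: "k n > 0" for n by (simp add: k_def)
  have r0: "r x \<ge> 0" for x by (simp add: r_def)
  have rpos: "r x > 0" if "x \<in> {c<..<d}" for x using that by (simp add: r_def)
  have rz: "r x = 0 \<and> r' x = 0" if "x \<notin> {c<..<d}" for x
    using that by (auto simp: r_def r'_def max_def)
  have dr: "(r has_real_derivative r' x) (at x)" for x
  proof -
    have 1: "((\<lambda>x. (max 0 (x - c))\<^sup>2) has_real_derivative (2 * max 0 (x - c)) * 1) (at x)"
      by (rule DERIV_chain2[OF DERIV_pos_part_square]) (auto intro!: derivative_eq_intros)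
    have 2: "((\<lambda>x. (max 0 (d - x))\<^sup>2) has_real_derivative (2 * max 0 (d - x)) * (- 1)) (at x)"
      by (rule DERIV_chain2[OF DERIV_pos_part_square]) (auto intro!: derivative_eq_intros)
    show ?thesis unfolding r_def[abs_def] r'_def
      by (rule derivative_eq_intros 1 2 refl)+ (simp add: algebra_simps)
  qed
  have cr: "continuous_on UNIV r" "continuous_on UNIV r'"
    unfolding r_def[abs_def] r'_def[abs_def] by (intro continuous_intros)+
  have pos: "0 < k n + r x" for n x using kpos[of n] r0[of x] by linarith
  show ?thesis
  proof
    fix n x
    show "bump_fun c d (\<lambda>x. r x / (k n + r x)) (\<lambda>x. k n * r' x / (k n + r x)\<^sup>2)"
      unfolding bump_fun_def
    proof (intro conjI allI impI)
      show "((\<lambda>x. r x / (k n + r x)) has_real_derivative k n * r' x / (k n + r x)\<^sup>2) (at x)" for x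
      proof -
        have "((\<lambda>x. r x / (k n + r x)) has_real_derivative
            (r' x * (k n + r x) - r x * (0 + r' x)) / ((k n + r x) * (k n + r x))) (at x)"
          by (intro DERIV_divide DERIV_add DERIV_const dr) (use pos[of n x] in simp)
        then show ?thesis by (rule DERIV_cong) (simp add: algebra_simps power2_eq_square)
      qed
      show "continuous_on UNIV (\<lambda>x. k n * r' x / (k n + r x)\<^sup>2)"
        by (intro continuous_intros cr) (metis pos less_irrefl zero_eq_power2)
    qed (use rz in auto)
    show "0 \<le> r x / (k n + r x)" "r x / (k n + r x) \<le> 1" using r0[of x] kpos[of n] pos[of n x] by auto
    show "0 < r x / (k n + r x)" if "x \<in> {c<..<d}" using rpos[OF that] pos[of n x] by simp
  next
    fix x assume x: "x \<in> {c<..<d}"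
    have "k \<longlonglongrightarrow> 0" unfolding k_def by (rule LIMSEQ_inverse_real_of_nat)
    then have "(\<lambda>n. r x / (k n + r x)) \<longlonglongrightarrow> r x / (0 + r x)"
      using rpos[OF x] by (intro tendsto_intros) auto
    then show "(\<lambda>n. r x / (k n + r x)) \<longlonglongrightarrow> 1" using rpos[OF x] by simp
  qed
qed

text \<open>Lebesgue differentiation: off a null set \<open>w x\<close> is the limit of the averages
  of \<open>w\<close> over \<open>[x, x + h]\<close>, and for small \<open>h\<close> all of these
  vanish.\<close>

lemma negligible_nonzero_of_integral_zero:
  fixes w :: "real \<Rightarrow> complex"
  assumes int: "w integrable_on {c..d}"
    and zero: "\<And>p q. c < p \<Longrightarrow> p < q \<Longrightarrow> q < d \<Longrightarrow> integral {p..q} w = 0"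
  shows "negligible {x \<in> {c<..<d}. w x \<noteq> 0}"
proof -
  \<comment> \<open>The differentiation theorem speaks of functions integrable on every box, so
    \<open>w\<close> is extended by zero.\<close>
  define f where "f x = (if x \<in> {c..d} then w x else 0)" for x
  have "f integrable_on UNIV"
    using int integrable_restrict_UNIV[of "{c..d}" w] by (simp add: f_def[abs_def])
  then have "f integrable_on cbox p q" for p q
    by (rule integrable_on_subcbox) auto
  then obtain N where N: "negligible N"
     "\<And>x e. \<lbrakk>x \<notin> N; 0 < e\<rbrakk> \<Longrightarrow> \<exists>d>0. \<forall>h. 0 < h \<and> h < d \<longrightarrow>
         norm (integral (cbox x (x + h *\<^sub>R One)) f /\<^sub>R h ^ DIM(real) - f x) < e"
    using integrable_ccontinuous_explicit[of f] by metis
  have "w x = 0" if x: "x \<in> {c<..<d}" "x \<notin> N" for x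
  proof (rule ccontr)
    assume "w x \<noteq> 0"
    then obtain D where D: "D > 0" "\<And>h. 0 < h \<Longrightarrow> h < D \<Longrightarrow>
         norm (integral (cbox x (x + h *\<^sub>R One)) f /\<^sub>R h ^ DIM(real) - f x) < norm (w x)"
      using N(2)[OF x(2), of "norm (w x)"] by auto
    define h where "h = min (D / 2) ((d - x) / 2)"
    have h: "0 < h" "h < D" "x + h < d" using D x by (auto simp: h_def min_def field_simps)
    have "integral (cbox x (x + h *\<^sub>R One)) f = integral {x..x+h} w"
      unfolding f_def using x h by (auto intro!: integral_cong)
    also have "\<dots> = 0" using x h by (intro zero) auto
    finally show False using D(2)[OF h(1,2)] x by (simp add: f_def)
  qed
  then have "{x \<in> {c<..<d}. w x \<noteq> 0} \<subseteq> N" by auto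
  then show ?thesis using N(1) negligible_subset by blast
qed

text \<open>Bumps increasing to the indicator of \<open>{c<..<d}\<close>, with dominated
  convergence, make the integral of \<open>w\<close> over each compact subinterval vanish; the
  differentiation argument then gives \<open>w = 0\<close>.\<close>

lemma fundamental_lemma_calculus_of_variations:
  assumes loc: "locally_integrable a b w"
    and zero: "\<And>c d \<phi> \<phi>'. a < c \<Longrightarrow> c < d \<Longrightarrow> d < b \<Longrightarrow> bump_fun c d \<phi> \<phi>' \<Longrightarrow>
      integral {c..d} (\<lambda>x. w x * of_real (\<phi> x)) = 0"
  shows "AE x in lebesgue_on {a<..<b}. w x = 0"
proof -
  have int0: "integral {c..d} w = 0" if cd: "a < c" "c < d" "d < b" for c d
  proof -
    obtain \<phi> \<phi>' where ph: "\<And>n. bump_fun c d (\<phi> n) (\<phi>' n)" "\<And>n x. 0 \<le> \<phi> n x" "\<And>n x. \<phi> n x \<le> 1"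
      "\<And>x. x \<in> {c<..<d} \<Longrightarrow> (\<lambda>n. \<phi> n x) \<longlonglongrightarrow> 1"
      using bump_sequence[of c d] by metis
    have wi: "w absolutely_integrable_on {c..d}" using locally_integrable_Icc[OF loc] cd by auto
    have fi: "(\<lambda>x. w x * of_real (\<phi> n x)) integrable_on {c<..<d}" for n
    proof -
      have "(\<lambda>x. of_real (\<phi> n x) * w x) absolutely_integrable_on {c..d}"
        by (rule absolutely_integrable_continuous_mult[OF _ wi])
          (intro continuous_intros bump_fun_continuous[OF ph(1)])
      then have "(\<lambda>x. w x * of_real (\<phi> n x)) absolutely_integrable_on {c..d}" by (simp add: mult.commute)
      then show ?thesis
        using set_lebesgue_integral_eq_integral(1) absolutely_integrable_on_Icc_iff_Ioo by blast
    qed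
    have "(\<lambda>n. integral {c<..<d} (\<lambda>x. w x * of_real (\<phi> n x))) \<longlonglongrightarrow> integral {c<..<d} w"
    proof (rule dominated_convergence(2)[OF fi])
      show "(\<lambda>x. norm (w x)) integrable_on {c<..<d}"
        using wi absolutely_integrable_on_Icc_iff_Ioo absolutely_integrable_on_def by blast
      show "norm (w x * of_real (\<phi> n x)) \<le> norm (w x)" for n x
        using ph(2)[of n x] ph(3)[of n x] by (auto simp: norm_mult intro!: mult_left_le)
      show "(\<lambda>n. w x * of_real (\<phi> n x)) \<longlonglongrightarrow> w x" if "x \<in> {c<..<d}" for x
        using tendsto_mult_left[OF tendsto_of_real[OF ph(4)[OF that]], of "w x"] by simp
    qed
    moreover have "integral {c<..<d} (\<lambda>x. w x * of_real (\<phi> n x)) = 0" for n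
      using zero[OF cd ph(1)] by (simp add: integral_open_interval_real)
    ultimately have "integral {c<..<d} w = 0"
      by (simp add: LIMSEQ_const_iff)
    then show ?thesis by (simp add: integral_open_interval_real)
  qed
  \<comment> \<open>Local integrability allows no integration up to \<open>a\<close> or
    \<open>b\<close>, so the interval is exhausted by countably many intervals shrunk by
    \<open>k n\<close> at each end.\<close>
  define k where "k n = inverse (real (Suc n))" for n
  have kpos: "k n > 0" for n by (simp add: k_def)
  have N: "negligible {x \<in> {a + k n<..<b - k n}. w x \<noteq> 0}" for n
  proof (rule negligible_nonzero_of_integral_zero)
    show "w integrable_on {a + k n..b - k n}"
      using locally_integrable_Icc[OF loc, of "a + k n" "b - k n"] kpos[of n]
      by (intro set_lebesgue_integral_eq_integral(1)) auto
    show "integral {p..q} w = 0" if "a + k n < p" "p < q" "q < b - k n" for p q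
      using that kpos[of n] by (intro int0) auto
  qed
  have "{x \<in> {a<..<b}. \<not> w x = 0} \<subseteq> (\<Union>n. {x \<in> {a + k n<..<b - k n}. w x \<noteq> 0})"
  proof
    fix x assume x: "x \<in> {x \<in> {a<..<b}. \<not> w x = 0}"
    then obtain n where "k n < min (x - a) (b - x)"
      using reals_Archimedean[of "min (x - a) (b - x)"] by (auto simp: k_def)
    then have "x \<in> {x \<in> {a + k n<..<b - k n}. w x \<noteq> 0}" using x by auto
    then show "x \<in> (\<Union>n. {x \<in> {a + k n<..<b - k n}. w x \<noteq> 0})" by blast
  qed
  then have "negligible {x \<in> {a<..<b}. \<not> w x = 0}"
    using N negligible_countable_Union[of "range (\<lambda>n. {x \<in> {a + k n<..<b - k n}. w x \<noteq> 0})"]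
    by (auto intro: negligible_subset)
  then show ?thesis by (simp add: AE_lebesgue_on_iff_negligible)
qed

section \<open>Weak derivatives tested against bump functions\<close>

lemma bump_fun_test_function:
  assumes "bump_fun c d \<phi> \<phi>'" "a < c" "d < b"
  shows "(\<lambda>x. of_real (\<phi> x)) \<in> test_functions a b"
    "vector_derivative (\<lambda>x. of_real (\<phi> x) :: complex) (at x) = of_real (\<phi>' x)"
proof -
  have D: "((\<lambda>x. of_real (\<phi> x) :: complex) has_vector_derivative of_real (\<phi>' x)) (at x)" for x
    using assms(1) has_vector_derivative_of_real
    by (auto simp: bump_fun_def has_real_derivative_iff_has_vector_derivative)
  then show "vector_derivative (\<lambda>x. of_real (\<phi> x) :: complex) (at x) = of_real (\<phi>' x)"
    by (rule vector_derivative_at)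
  have sub: "closure {x. (of_real (\<phi> x) :: complex) \<noteq> 0} \<subseteq> {c..d}"
    by (rule closure_minimal) (use assms(1) in \<open>auto simp: bump_fun_def\<close>, (metis greaterThanLessThan_iff less_imp_le)+)
  have "continuous_on UNIV (\<lambda>x. of_real (\<phi>' x) :: complex)"
    by (intro continuous_intros bump_fun_continuous[OF assms(1)])
  then have "(\<lambda>x. of_real (\<phi> x) :: complex) C1_differentiable_on UNIV"
    unfolding C1_differentiable_on_def using D by (intro exI[of _ "\<lambda>x. of_real (\<phi>' x)"]) auto
  moreover have "compact (closure {x. (of_real (\<phi> x) :: complex) \<noteq> 0})"
    using sub by (meson bounded_closed_interval bounded_subset closed_closure compact_eq_bounded_closed)
  ultimately show "(\<lambda>x. of_real (\<phi> x)) \<in> test_functions a b"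
    using sub assms(2,3) by (fastforce simp: test_functions_def)
qed

text \<open>Translates the Lebesgue integral on the open interval, in which weak derivatives are
  defined, into a gauge integral over a compact subinterval, where local integrability is
  enough.\<close>

lemma LINT_compact_support:
  fixes w :: "real \<Rightarrow> complex"
  assumes "locally_integrable a b w" "a < c" "d < b" "continuous_on {c..d} \<psi>"
    and zero: "\<And>x. x \<notin> {c..d} \<Longrightarrow> \<psi> x = 0"
  shows "(LINT x|lebesgue_on {a<..<b}. w x * of_real (\<psi> x)) = integral {c..d} (\<lambda>x. w x * of_real (\<psi> x))"
proof -
  have "(\<lambda>x. of_real (\<psi> x) * w x) absolutely_integrable_on {c..d}"
    by (rule absolutely_integrable_continuous_mult)
      (use assms locally_integrable_Icc in \<open>auto intro!: continuous_intros\<close>)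
  then have i: "(\<lambda>x. w x * of_real (\<psi> x)) absolutely_integrable_on {c..d}" by (simp add: mult.commute)
  have N: "negligible {x \<in> {c..d} - {a..b}. w x * of_real (\<psi> x) \<noteq> 0}"
    "negligible {x \<in> {a..b} - {c..d}. w x * of_real (\<psi> x) \<noteq> 0}"
    by (rule negligible_subset[OF negligible_empty]; use assms in auto)+
  have "(\<lambda>x. w x * of_real (\<psi> x)) absolutely_integrable_on {a..b}"
    by (rule absolutely_integrable_spike_set[OF i N])
  then show ?thesis
    by (subst LINT_eq_integral_Icc) (auto intro: integral_spike_set[OF N(2,1)])
qed

lemma has_weak_deriv_bump:
  assumes "has_weak_deriv a b u g" "a < c" "d < b" "bump_fun c d \<phi> \<phi>'"
  shows "integral {c..d} (\<lambda>x. u x * of_real (\<phi>' x)) = - integral {c..d} (\<lambda>x. g x * of_real (\<phi> x))"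
proof -
  have "(LINT x|lebesgue_on {a<..<b}. u x * of_real (\<phi>' x)) = - (LINT x|lebesgue_on {a<..<b}. g x * of_real (\<phi> x))"
    using assms(1) bump_fun_test_function[OF assms(4,2,3)] by (auto simp: has_weak_deriv_def)
  moreover have "(LINT x|lebesgue_on {a<..<b}. u x * of_real (\<phi>' x)) = integral {c..d} (\<lambda>x. u x * of_real (\<phi>' x))"
    "(LINT x|lebesgue_on {a<..<b}. g x * of_real (\<phi> x)) = integral {c..d} (\<lambda>x. g x * of_real (\<phi> x))"
    using assms bump_fun_continuous[OF assms(4)]
    by (auto intro!: LINT_compact_support simp: has_weak_deriv_def bump_fun_def)
  ultimately show ?thesis by simp
qed

lemma integrable_bump_mult:
  assumes "locally_integrable a b w" "a < c" "d < b" "continuous_on {c..d} \<psi>"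
  shows "(\<lambda>x. w x * of_real (\<psi> x)) integrable_on {c..d}"
proof -
  have "(\<lambda>x. of_real (\<psi> x) * w x) absolutely_integrable_on {c..d}"
    by (rule absolutely_integrable_continuous_mult)
      (use assms locally_integrable_Icc in \<open>auto intro!: continuous_intros\<close>)
  then show ?thesis using set_lebesgue_integral_eq_integral(1) by (simp add: mult.commute)
qed

lemma has_weak_deriv_unique:
  assumes g: "has_weak_deriv a b u g" and h: "has_weak_deriv a b u h"
  shows "AE x in lebesgue_on {a<..<b}. g x = h x"
proof -
  have gl: "locally_integrable a b g" and hl: "locally_integrable a b h"
    using g h by (auto simp: has_weak_deriv_def)
  have "AE x in lebesgue_on {a<..<b}. g x - h x = 0"
  proof (rule fundamental_lemma_calculus_of_variations[OF locally_integrable_diff[OF gl hl]])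
    fix c d \<phi> \<phi>' assume cd: "a < c" "c < d" "d < b" and ph: "bump_fun c d \<phi> \<phi>'"
    have i: "(\<lambda>x. g x * of_real (\<phi> x)) integrable_on {c..d}" "(\<lambda>x. h x * of_real (\<phi> x)) integrable_on {c..d}"
      using cd gl hl bump_fun_continuous[OF ph] by (auto intro!: integrable_bump_mult)
    have "integral {c..d} (\<lambda>x. (g x - h x) * of_real (\<phi> x))
      = integral {c..d} (\<lambda>x. g x * of_real (\<phi> x)) - integral {c..d} (\<lambda>x. h x * of_real (\<phi> x))"
      using i by (simp add: left_diff_distrib integral_diff)
    also have "\<dots> = 0"
      using has_weak_deriv_bump[OF g cd(1,3) ph] has_weak_deriv_bump[OF h cd(1,3) ph] by simp
    finally show "integral {c..d} (\<lambda>x. (g x - h x) * of_real (\<phi> x)) = 0" .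
  qed
  then show ?thesis by simp
qed

lemma locally_integrable_cong_AE:
  assumes "locally_integrable a b u" "AE x in lebesgue_on {a<..<b}. u x = v x"
  shows "locally_integrable a b v"
  unfolding locally_integrable_def
proof (intro allI impI)
  fix c d assume cd: "{c..d} \<subseteq> {a<..<b}"
  show "v absolutely_integrable_on {c..d}"
  proof (rule absolutely_integrable_spike)
    show "u absolutely_integrable_on {c..d}" using assms(1) cd by (auto simp: locally_integrable_def)
    show "negligible {x \<in> {a<..<b}. \<not> u x = v x}"
      using assms(2) by (simp add: AE_lebesgue_on_iff_negligible)
  qed (use cd in auto)
qed

lemma has_weak_deriv_cong_AE:
  assumes "has_weak_deriv a b u g"
    and u: "AE x in lebesgue_on {a<..<b}. u x = v x" and g: "AE x in lebesgue_on {a<..<b}. g x = h x"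
  shows "has_weak_deriv a b v h"
  unfolding has_weak_deriv_def
proof (intro conjI ballI)
  show "locally_integrable a b v" "locally_integrable a b h"
    using assms locally_integrable_cong_AE by (auto simp: has_weak_deriv_def)
  fix \<phi> assume ph: "\<phi> \<in> test_functions a b"
  have "(LINT x|lebesgue_on {a<..<b}. v x * vector_derivative \<phi> (at x))
      = (LINT x|lebesgue_on {a<..<b}. u x * vector_derivative \<phi> (at x))"
    using u by (intro LINT_cong_AE_lebesgue_on) auto
  moreover have "(LINT x|lebesgue_on {a<..<b}. h x * \<phi> x) = (LINT x|lebesgue_on {a<..<b}. g x * \<phi> x)"
    using g by (intro LINT_cong_AE_lebesgue_on) auto
  ultimately show "(LINT x|lebesgue_on {a<..<b}. v x * vector_derivative \<phi> (at x))
      = - (LINT x|lebesgue_on {a<..<b}. h x * \<phi> x)"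
    using assms(1) ph by (simp add: has_weak_deriv_def)
qed

lemma wderiv_works:
  assumes "has_weak_deriv a b u g"
  shows "has_weak_deriv a b u (wderiv a b u)" "AE x in lebesgue_on {a<..<b}. wderiv a b u x = g x"
proof -
  show "has_weak_deriv a b u (wderiv a b u)"
    unfolding wderiv_def by (rule someI[of "has_weak_deriv a b u"]) (rule assms)
  then show "AE x in lebesgue_on {a<..<b}. wderiv a b u x = g x"
    using assms by (rule has_weak_deriv_unique)
qed

text \<open>Integration by parts is the product rule for \<open>u\<close> and the test function,
  integrated over \<open>{a..b}\<close>; the boundary terms vanish because the closed support avoids
  both end points.\<close>

lemma primitive_on_has_weak_deriv:
  assumes "a < b" and u: "primitive_on a b u g"
  shows "has_weak_deriv a b u g"
  unfolding has_weak_deriv_def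
proof (intro conjI ballI)
  note cu = primitive_on_continuous[OF u]
  show "locally_integrable a b u"
    by (rule absolutely_integrable_locally_integrable[OF absolutely_integrable_continuous_real[OF cu]])
  show "locally_integrable a b g"
    by (rule absolutely_integrable_locally_integrable[OF primitive_on_integrable(1)[OF u]])
  fix \<phi> assume ph: "\<phi> \<in> test_functions a b"
  define \<phi>' where "\<phi>' x = vector_derivative \<phi> (at x)" for x
  obtain D where D: "\<And>x. (\<phi> has_vector_derivative D x) (at x)" "continuous_on UNIV D"
    using ph by (auto simp: test_functions_def C1_differentiable_on_def)
  have "\<phi>' = D" unfolding \<phi>'_def by (intro ext vector_derivative_at D)
  have phi: "primitive_on a b \<phi> D"
    by (rule primitive_on_C1[OF has_vector_derivative_at_within[OF D(1)] continuous_on_subset[OF D(2)]]) auto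
  have "a \<notin> closure {x. \<phi> x \<noteq> 0}" "b \<notin> closure {x. \<phi> x \<noteq> 0}"
    using ph by (auto simp: test_functions_def)
  then have z: "\<phi> a = 0" "\<phi> b = 0" using closure_subset[of "{x. \<phi> x \<noteq> 0}"] by auto
  have i1: "(\<lambda>x. u x * D x) absolutely_integrable_on {a..b}"
    using cu primitive_on_integrable(1)[OF phi] by (rule absolutely_integrable_continuous_mult)
  have i2: "(\<lambda>x. \<phi> x * g x) absolutely_integrable_on {a..b}"
    using primitive_on_continuous[OF phi] primitive_on_integrable(1)[OF u] by (rule absolutely_integrable_continuous_mult)
  have "integral {a..b} (\<lambda>x. u x * D x + \<phi> x * g x) = u b * \<phi> b - u a * \<phi> a"
    using primitive_on_diff[OF primitive_on_mult[OF u phi], of a b] assms by auto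
  then have "integral {a..b} (\<lambda>x. u x * D x) + integral {a..b} (\<lambda>x. \<phi> x * g x) = 0"
    using z i1 i2 set_lebesgue_integral_eq_integral(1) by (subst (asm) integral_add) auto
  moreover have "(LINT x|lebesgue_on {a<..<b}. u x * \<phi>' x) = integral {a..b} (\<lambda>x. u x * D x)"
    using LINT_eq_integral_Icc[OF i1] \<open>\<phi>' = D\<close> by simp
  moreover have "(LINT x|lebesgue_on {a<..<b}. g x * \<phi> x) = integral {a..b} (\<lambda>x. \<phi> x * g x)"
    using LINT_eq_integral_Icc[OF i2] by (simp add: mult.commute)
  ultimately show "(LINT x|lebesgue_on {a<..<b}. u x * vector_derivative \<phi> (at x)) =
        - (LINT x|lebesgue_on {a<..<b}. g x * \<phi> x)"
    by (simp add: \<phi>'_def eq_neg_iff_add_eq_0)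
qed

section \<open>From weak derivatives back to primitives\<close>

lemma antiderivative_real:
  fixes \<xi> :: "real \<Rightarrow> real"
  assumes "continuous_on UNIV \<xi>"
  shows "\<exists>F. \<forall>x. (F has_real_derivative \<xi> x) (at x)"
proof -
  have "\<exists>F. \<forall>x::real. -\<infinity> < x \<longrightarrow> x < \<infinity> \<longrightarrow> (F has_vector_derivative \<xi> x) (at x)"
    by (rule einterval_antiderivative) (use assms in \<open>auto simp: continuous_on_eq_continuous_at\<close>)
  then obtain F where F: "\<forall>x::real. -\<infinity> < x \<longrightarrow> x < \<infinity> \<longrightarrow> (F has_vector_derivative \<xi> x) (at x)" ..
  show ?thesis
    by (rule exI[of _ F]) (use F in \<open>simp add: has_real_derivative_iff_has_vector_derivative\<close>)
qed

text \<open>Mean zero makes an antiderivative take the same constant value on both sides of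
  \<open>{p<..<q}\<close>; subtracting that constant leaves a compactly supported function.\<close>

lemma primitive_bump_fun:
  fixes \<xi> :: "real \<Rightarrow> real"
  assumes cont: "continuous_on UNIV \<xi>" and pq: "p \<le> q"
    and zero: "\<And>x. x \<notin> {p<..<q} \<Longrightarrow> \<xi> x = 0" and int: "integral {p..q} \<xi> = 0"
  obtains \<phi> where "bump_fun p q \<phi> \<xi>"
proof -
  obtain F where F: "\<And>x. (F has_real_derivative \<xi> x) (at x)" using antiderivative_real[OF cont] by blast
  have ftc: "(\<xi> has_integral (F y - F x)) {x..y}" if "x \<le> y" for x y
    by (rule fundamental_theorem_of_calculus[OF that])
      (use F in \<open>auto simp: has_real_derivative_iff_has_vector_derivative intro: has_vector_derivative_at_within\<close>)
  have const: "F y = F x" if "x \<le> y" "y \<le> p \<or> q \<le> x" for x y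
  proof -
    have "(\<xi> has_integral 0) {x..y}" by (rule has_integral_is_0) (use zero that in auto)
    from has_integral_unique[OF this ftc[OF that(1)]] show ?thesis by simp
  qed
  have "F q = F p" using integral_unique[OF ftc[OF pq]] int by simp
  then have z: "F x - F p = 0" if "x \<notin> {p<..<q}" for x
    using const[of x p] const[of q x] that by (cases "x \<le> p") auto
  have D: "((\<lambda>x. F x - F p) has_real_derivative \<xi> x) (at x)" for x
    using DERIV_diff[OF F[of x] DERIV_const[of "F p"]] by simp
  have "bump_fun p q (\<lambda>x. F x - F p) \<xi>"
    unfolding bump_fun_def using cont zero z D by blast
  then show ?thesis using that by blast
qed

lemma integral_compact_support:
  fixes f :: "real \<Rightarrow> 'a::euclidean_space"
  assumes "p \<le> c" "d \<le> q" "\<And>x. x \<notin> {c<..<d} \<Longrightarrow> f x = 0"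
  shows "integral {p..q} f = integral {c..d} f"
proof (rule integral_spike_set)
  have zero: "f x = 0" if "x \<notin> {c..d}" for x using assms(3)[of x] that by auto
  show "negligible {x \<in> {p..q} - {c..d}. f x \<noteq> 0}" "negligible {x \<in> {c..d} - {p..q}. f x \<noteq> 0}"
    by (rule negligible_subset[OF negligible_empty]; use assms(1,2) zero in auto)+
qed

text \<open>Fix one bump \<open>\<eta>\<close> with nonzero integral. Subtracting a multiple of
  \<open>\<eta>\<close> from an arbitrary bump \<open>\<psi>\<close> gives mean zero, hence the
  derivative of a bump, which \<open>w\<close> annihilates. So \<open>w\<close> acts on
  \<open>\<psi>\<close> as a constant times the integral of \<open>\<psi>\<close>, and the
  fundamental lemma identifies \<open>w\<close> with that constant.\<close>

lemma du_Bois_Reymond: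
  assumes ab: "a < b" and loc: "locally_integrable a b w"
    and zero: "\<And>c d \<phi> \<phi>'. a < c \<Longrightarrow> c < d \<Longrightarrow> d < b \<Longrightarrow> bump_fun c d \<phi> \<phi>' \<Longrightarrow>
      integral {c..d} (\<lambda>x. w x * of_real (\<phi>' x)) = 0"
  obtains C where "AE x in lebesgue_on {a<..<b}. w x = C"
proof -
  \<comment> \<open>The middle third is one choice of an interval whose closure stays inside
    \<open>{a<..<b}\<close>.\<close>
  define c0 where "c0 = a + (b - a) / 3"
  define d0 where "d0 = a + 2 * (b - a) / 3"
  have cd0: "a < c0" "c0 < d0" "d0 < b" using ab by (auto simp: c0_def d0_def field_simps)
  obtain \<eta> \<eta>' where eta: "bump_fun c0 d0 \<eta> \<eta>'" "\<And>x. 0 \<le> \<eta> x" "\<And>x. x \<in> {c0<..<d0} \<Longrightarrow> 0 < \<eta> x"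
    using bump_sequence[of c0 d0] by metis
  define J where "J = integral {c0..d0} \<eta>"
  have ce: "continuous_on S \<eta>" for S using bump_fun_continuous eta(1) by blast
  have J: "J \<noteq> 0"
  proof
    assume "J = 0"
    then have "\<eta> ((c0 + d0) / 2) = 0"
      using integral_eq_0_iff[OF ce cd0(2) eta(2)] cd0(2) by (auto simp: J_def)
    then show False using eta(3)[of "(c0 + d0) / 2"] cd0(2) by (auto simp: field_simps)
  qed
  define C where "C = integral {c0..d0} (\<lambda>x. w x * of_real (\<eta> x)) / of_real J"
  have "AE x in lebesgue_on {a<..<b}. w x - C = 0"
  proof (rule fundamental_lemma_calculus_of_variations[OF locally_integrable_diff[OF loc locally_integrable_const]])
    fix c d \<psi> \<psi>' assume cd: "a < c" "c < d" "d < b" and psi: "bump_fun c d \<psi> \<psi>'"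
    have cp: "continuous_on S \<psi>" for S using bump_fun_continuous psi by blast
    \<comment> \<open>\<open>{p..q}\<close> contains the supports of both \<open>\<psi>\<close> and
      \<open>\<eta>\<close> and still lies strictly inside \<open>{a<..<b}\<close>, so the
      hypothesis applies on it.\<close>
    define p where "p = min c c0"
    define q where "q = max d d0"
    have pq: "a < p" "p < q" "q < b" "p \<le> c" "p \<le> c0" "d \<le> q" "d0 \<le> q" using cd cd0 by (auto simp: p_def q_def)
    define L where "L = integral {c..d} \<psi> / J"
    define \<xi> where "\<xi> x = \<psi> x - L * \<eta> x" for x
    have pz: "\<psi> x = 0" if "x \<notin> {c<..<d}" for x using psi that by (auto simp: bump_fun_def)
    have ez: "\<eta> x = 0" if "x \<notin> {c0<..<d0}" for x using eta(1) that by (auto simp: bump_fun_def)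
    have cx: "continuous_on UNIV \<xi>" unfolding \<xi>_def[abs_def] by (intro continuous_intros cp ce)
    have ipsi: "\<psi> integrable_on {p..q}" and ieta: "\<eta> integrable_on {p..q}"
      using cp ce by (auto intro: integrable_continuous_real)
    have "integral {p..q} \<xi> = integral {p..q} \<psi> - L * integral {p..q} \<eta>"
      unfolding \<xi>_def[abs_def]
      by (subst integral_diff) (auto intro!: ipsi ieta integrable_on_mult_right)
    also have "integral {p..q} \<psi> = integral {c..d} \<psi>"
      using pq pz by (intro integral_compact_support) auto
    also have "integral {p..q} \<eta> = J" unfolding J_def
      using pq ez by (intro integral_compact_support) auto
    finally have "integral {p..q} \<xi> = 0" using J by (simp add: L_def)
    moreover have "\<xi> x = 0" if "x \<notin> {p<..<q}" for x
      using pz[of x] ez[of x] that pq by (auto simp: \<xi>_def)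
    ultimately obtain \<phi> where "bump_fun p q \<phi> \<xi>"
      using primitive_bump_fun[OF cx less_imp_le[OF pq(2)]] by metis
    then have 0: "integral {p..q} (\<lambda>x. w x * of_real (\<xi> x)) = 0" using zero pq by blast
    have i1: "(\<lambda>x. w x * of_real (\<psi> x)) integrable_on {p..q}" and i2: "(\<lambda>x. w x * of_real (\<eta> x)) integrable_on {p..q}"
      using loc pq cp ce by (auto intro!: integrable_bump_mult)
    have "integral {p..q} (\<lambda>x. w x * of_real (\<xi> x)) =
      integral {p..q} (\<lambda>x. w x * of_real (\<psi> x) - of_real L * (w x * of_real (\<eta> x)))"
      by (simp add: \<xi>_def algebra_simps)
    also have "\<dots> = integral {p..q} (\<lambda>x. w x * of_real (\<psi> x)) - of_real L * integral {p..q} (\<lambda>x. w x * of_real (\<eta> x))"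
      using i1 i2 by (subst integral_diff) (auto intro!: integrable_on_mult_right)
    also have "integral {p..q} (\<lambda>x. w x * of_real (\<psi> x)) = integral {c..d} (\<lambda>x. w x * of_real (\<psi> x))"
      using pq pz by (intro integral_compact_support) auto
    also have "integral {p..q} (\<lambda>x. w x * of_real (\<eta> x)) = C * of_real J"
      using pq ez J by (subst integral_compact_support[of p c0 d0 q]) (auto simp: C_def)
    finally have 1: "integral {c..d} (\<lambda>x. w x * of_real (\<psi> x)) = C * of_real (integral {c..d} \<psi>)"
      using 0 J by (simp add: L_def)
    have "((\<lambda>x. of_real (\<psi> x) :: complex) has_integral of_real (integral {c..d} \<psi>)) {c..d}"
      by (rule has_integral_of_real) (use cp in \<open>auto intro!: integrable_integral integrable_continuous_real\<close>)
    then have 2: "((\<lambda>x. C * of_real (\<psi> x)) has_integral C * of_real (integral {c..d} \<psi>)) {c..d}"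
      by (rule has_integral_mult_right)
    have "((\<lambda>x. w x * of_real (\<psi> x)) has_integral integral {c..d} (\<lambda>x. w x * of_real (\<psi> x))) {c..d}"
      using loc cd cp by (auto intro!: integrable_integral integrable_bump_mult)
    from has_integral_diff[OF this 2] show "integral {c..d} (\<lambda>x. (w x - C) * of_real (\<psi> x)) = 0"
      using 1 by (simp add: left_diff_distrib integral_unique)
  qed
  then show ?thesis using that[of C] by simp
qed

text \<open>The difference between \<open>u\<close> and the indefinite integral of \<open>g\<close>
  has weak derivative zero, so it is constant almost everywhere; the constant is absorbed into
  \<open>U\<close>.\<close>

lemma has_weak_deriv_primitive_AE:
  assumes ab: "a < b" and u: "has_weak_deriv a b u g" and g: "g absolutely_integrable_on {a..b}"
  obtains U where "primitive_on a b U g" "AE x in lebesgue_on {a<..<b}. U x = u x"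
proof -
  define U0 where "U0 x = 0 + integral {a..x} g" for x
  have U0: "primitive_on a b U0 g" unfolding U0_def[abs_def] by (rule primitive_on_indefinite[OF g])
  then have w0: "has_weak_deriv a b U0 g" using primitive_on_has_weak_deriv ab by blast
  have lu: "locally_integrable a b u" "locally_integrable a b U0"
    using u w0 by (auto simp: has_weak_deriv_def)
  obtain C where C: "AE x in lebesgue_on {a<..<b}. u x - U0 x = C"
  proof (rule du_Bois_Reymond[OF ab locally_integrable_diff[OF lu]])
    fix c d \<phi> \<phi>' assume cd: "a < c" "c < d" "d < b" and ph: "bump_fun c d \<phi> \<phi>'"
    have "(\<lambda>x. u x * of_real (\<phi>' x)) integrable_on {c..d}" "(\<lambda>x. U0 x * of_real (\<phi>' x)) integrable_on {c..d}"
      using cd lu bump_fun_continuous[OF ph] by (auto intro!: integrable_bump_mult)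
    then show "integral {c..d} (\<lambda>x. (u x - U0 x) * of_real (\<phi>' x)) = 0"
      using has_weak_deriv_bump[OF u cd(1,3) ph] has_weak_deriv_bump[OF w0 cd(1,3) ph]
      by (simp add: left_diff_distrib integral_diff)
  qed auto
  have "primitive_on a b (\<lambda>x. U0 x + C) g"
    using U0 by (auto simp: primitive_on_def)
  moreover have "AE x in lebesgue_on {a<..<b}. U0 x + C = u x"
    using C by eventually_elim auto
  ultimately show ?thesis using that by blast
qed

lemma has_weak_deriv_primitive:
  assumes ab: "a < b" and u: "has_weak_deriv a b u g" and g: "g absolutely_integrable_on {a..b}"
    and cont: "continuous_on {a..b} u"
  shows "primitive_on a b u g"
proof -
  obtain U where U: "primitive_on a b U g" "AE x in lebesgue_on {a<..<b}. U x = u x"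
    using has_weak_deriv_primitive_AE[OF ab u g] .
  show ?thesis
    by (rule primitive_on_cong[OF U(1)])
      (use continuous_AE_eq[OF ab primitive_on_continuous[OF U(1)] cont U(2)] in auto)
qed

lemma W12_primitive:
  assumes "a < b" "u \<in> W12 a b"
  obtains U g where "has_weak_deriv a b u g" "primitive_on a b U g"
    "AE x in lebesgue_on {a<..<b}. U x = u x"
proof -
  obtain g where g: "g \<in> L2 {a<..<b}" "has_weak_deriv a b u g" using assms(2) by (auto simp: W12_def)
  then show ?thesis
    using that has_weak_deriv_primitive_AE[OF assms(1) g(2) L2_absolutely_integrable[OF g(1)]] by metis
qed

lemma W12_primitive_continuous:
  assumes "a < b" "u \<in> W12 a b" "continuous_on {a..b} u"
  obtains g where "has_weak_deriv a b u g" "primitive_on a b u g"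
proof -
  obtain g where g: "g \<in> L2 {a<..<b}" "has_weak_deriv a b u g" using assms(2) by (auto simp: W12_def)
  then show ?thesis
    using that has_weak_deriv_primitive[OF assms(1) g(2) L2_absolutely_integrable[OF g(1)] assms(3)] by blast
qed

lemma cont_rep_eq:
  assumes "a < b" "continuous_on {a..b} c" "AE x in lebesgue_on {a<..<b}. c x = u x" "x \<in> {a..b}"
  shows "cont_rep a b u x = c x"
proof -
  have *: "continuous_on {a..b} (cont_rep a b u) \<and> (AE x in lebesgue_on {a<..<b}. cont_rep a b u x = u x)"
    unfolding cont_rep_def
    by (rule someI[of "\<lambda>c. continuous_on {a..b} c \<and> (AE x in lebesgue_on {a<..<b}. c x = u x)" c])
      (intro conjI assms)
  have "AE x in lebesgue_on {a<..<b}. cont_rep a b u x = c x"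
    using conjunct2[OF *] assms(3) by eventually_elim simp
  then show ?thesis
    using continuous_AE_eq[OF assms(1) conjunct1[OF *] assms(2)] assms(4) by blast
qed

text \<open>Evaluates the arbitrarily chosen \<open>wderiv\<close>. Allowing \<open>u\<close> to
  differ from the primitive on a null set is essential for nested expressions such as
  \<open>f x * Dop l f y x\<close>, which themselves contain a chosen version.\<close>

lemma primitive_on_wderiv:
  assumes "a < b" "primitive_on a b U g" "AE x in lebesgue_on {a<..<b}. U x = u x"
  shows "AE x in lebesgue_on {a<..<b}. wderiv a b u x = g x"
proof -
  have "has_weak_deriv a b u g"
    by (rule has_weak_deriv_cong_AE[OF primitive_on_has_weak_deriv[OF assms(1,2)] assms(3)]) simp
  then show ?thesis by (rule wderiv_works(2))
qed

subsection \<open>Exponential solutions\<close>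

lemma primitive_on_cong_AE_Ioo:
  assumes "primitive_on a b u g" "AE x in lebesgue_on {a<..<b}. h x = g x"
  shows "primitive_on a b u h"
proof (rule primitive_on_cong_AE[OF assms(1)])
  show "negligible ({x \<in> {a<..<b}. \<not> h x = g x} \<union> {a, b})"
    using assms(2) by (auto simp: AE_lebesgue_on_iff_negligible)
qed auto

lemma primitive_on_divide:
  assumes "primitive_on a b y y'" "primitive_on a b f f'" "\<And>x. x \<in> {a..b} \<Longrightarrow> f x \<noteq> 0"
  obtains g where "primitive_on a b (\<lambda>x. y x / f x) g"
  using primitive_on_mult[OF assms(1) primitive_on_inverse[OF assms(2,3)]] that by simp

text \<open>The second unknown is the quasi-derivative \<open>w = f * Dop l f y\<close>. Since
  \<open>Dop l f y\<close> is \<open>f\<close> times the derivative of \<open>y / f\<close>,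
  dividing by \<open>(f x)\<^sup>2\<close> gives the first equation; the second is the Schroedinger
  equation multiplied by \<open>- f\<close>. No derivative of \<open>f\<close> remains in the
  system.\<close>

lemma schroedinger_exp_system:
  assumes l: "0 < l" and f: "primitive_on 0 l f f'" and nz: "\<And>x. x \<in> {0..l} \<Longrightarrow> f x \<noteq> 0" and f0: "f 0 = 1"
    and y: "schroedinger_exp l f \<rho> y"
  obtains w where "primitive_on 0 l (\<lambda>x. y x / f x) (\<lambda>x. w x / (f x)\<^sup>2)"
    "primitive_on 0 l w (\<lambda>x. - \<rho>\<^sup>2 * (f x)\<^sup>2 * (y x / f x))" "w 0 = \<i> * \<rho>"
proof -
  have yW: "y \<in> W12 0 l" and DW: "Dop l f y \<in> W12 0 l" and yc: "continuous_on {0..l} y"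
    and eq: "AE x in lebesgue_on {0<..<l}. schroedinger l f y x = \<rho>\<^sup>2 * y x"
    and D0: "cont_rep 0 l (Dop l f y) 0 = \<i> * \<rho>"
    using y by (auto simp: schroedinger_exp_def schroedinger_dom_def)
  obtain y' where y': "primitive_on 0 l y y'" using W12_primitive_continuous[OF l yW yc] by blast
  obtain k where k: "primitive_on 0 l (\<lambda>x. y x / f x) k" using primitive_on_divide[OF y' f nz] by blast
  have dk: "AE x in lebesgue_on {0<..<l}. wderiv 0 l (\<lambda>s. y s / f s) x = k x"
    by (rule primitive_on_wderiv[OF l k]) simp
  \<comment> \<open>\<open>p\<close> is the absolutely continuous representative of
    \<open>Dop l f y\<close>; only through it do a product rule for \<open>w\<close> and an initial
    value make sense.\<close>
  obtain p p' where p: "primitive_on 0 l p p'" "AE x in lebesgue_on {0<..<l}. p x = Dop l f y x"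
    using W12_primitive[OF l DW] by metis
  have "cont_rep 0 l (Dop l f y) 0 = p 0"
    by (rule cont_rep_eq[OF l primitive_on_continuous[OF p(1)] p(2)]) (use l in simp)
  then have p0: "p 0 = \<i> * \<rho>" using D0 by simp
  define w where "w x = f x * p x" for x
  define W where "W x = f x * p' x + p x * f' x" for x
  have w: "primitive_on 0 l w W"
    unfolding w_def[abs_def] W_def[abs_def] by (rule primitive_on_mult[OF f p(1)])
  have "AE x in lebesgue_on {0<..<l}. w x = f x * Dop l f y x"
    using p(2) by eventually_elim (simp add: w_def)
  then have dW: "AE x in lebesgue_on {0<..<l}. wderiv 0 l (\<lambda>x. f x * Dop l f y x) x = W x"
    by (rule primitive_on_wderiv[OF l w])
  have in_dom: "AE x in lebesgue_on {0<..<l}. x \<in> {0<..<l}"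
    by (rule AE_I2) (simp add: space_restrict_space)
  have "AE x in lebesgue_on {0<..<l}. w x / (f x)\<^sup>2 = k x"
    using dk p(2) in_dom
  proof eventually_elim
    case (elim x)
    then show ?case using nz[of x] by (simp add: w_def Dop_def power2_eq_square)
  qed
  with k have 1: "primitive_on 0 l (\<lambda>x. y x / f x) (\<lambda>x. w x / (f x)\<^sup>2)"
    by (rule primitive_on_cong_AE_Ioo)
  \<comment> \<open>\<open>Dop_inv\<close> turns the equation into
    \<open>- W / f = \<rho>\<^sup>2 * y\<close>; the factor \<open>y\<close> is then rewritten as
    \<open>f * (y / f)\<close>.\<close>
  have "AE x in lebesgue_on {0<..<l}. - \<rho>\<^sup>2 * (f x)\<^sup>2 * (y x / f x) = W x"
    using dW eq in_dom
  proof eventually_elim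
    case (elim x)
    then have "f x \<noteq> 0" "- (1 / f x * W x) = \<rho>\<^sup>2 * y x"
      using nz[of x] by (auto simp: schroedinger_def Dop_inv_def)
    then show ?case by (simp add: field_simps power2_eq_square) (metis minus_minus)
  qed
  with w have 2: "primitive_on 0 l w (\<lambda>x. - \<rho>\<^sup>2 * (f x)\<^sup>2 * (y x / f x))"
    by (rule primitive_on_cong_AE_Ioo)
  show ?thesis by (rule that[OF 1 2]) (simp add: w_def f0 p0)
qed

text \<open>Here the second unknown is \<open>w = f\<^sup>2 * v'\<close>, whose absolute continuity
  comes from \<open>v'\<close> being in \<open>W12\<close>. The system coincides with the one for
  \<open>y / f\<close>, and \<open>f 0 = 1\<close> gives the same initial value of
  \<open>w\<close>.\<close>

lemma impedance_exp_system:
  assumes l: "0 < l" and f: "primitive_on 0 l f f'" and nz: "\<And>x. x \<in> {0..l} \<Longrightarrow> f x \<noteq> 0" and f0: "f 0 = 1"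
    and v: "impedance_exp l f \<rho> v"
  obtains w where "primitive_on 0 l v (\<lambda>x. w x / (f x)\<^sup>2)"
    "primitive_on 0 l w (\<lambda>x. - \<rho>\<^sup>2 * (f x)\<^sup>2 * v x)" "w 0 = \<i> * \<rho>"
proof -
  obtain g where g: "g \<in> W12 0 l" "has_weak_deriv 0 l v g"
    using v by (auto simp: impedance_exp_def W22_def)
  have vc: "continuous_on {0..l} v"
    and eq: "AE x in lebesgue_on {0<..<l}. impedance l f v x = \<rho>\<^sup>2 * v x"
    and D0: "cont_rep 0 l (wderiv 0 l v) 0 = \<i> * \<rho>"
    using v by (auto simp: impedance_exp_def)
  have "g \<in> L2 {0<..<l}" using g(1) by (simp add: W12_def)
  then have k: "primitive_on 0 l v g"
    using has_weak_deriv_primitive[OF l g(2) _ vc] L2_absolutely_integrable by blast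
  have dk: "AE x in lebesgue_on {0<..<l}. wderiv 0 l v x = g x" by (rule wderiv_works(2)[OF g(2)])
  obtain p p' where p: "primitive_on 0 l p p'" "AE x in lebesgue_on {0<..<l}. p x = g x"
    using W12_primitive[OF l g(1)] by metis
  have pd: "AE x in lebesgue_on {0<..<l}. p x = wderiv 0 l v x"
    using p(2) dk by eventually_elim simp
  have "cont_rep 0 l (wderiv 0 l v) 0 = p 0"
    by (rule cont_rep_eq[OF l primitive_on_continuous[OF p(1)] pd]) (use l in simp)
  then have p0: "p 0 = \<i> * \<rho>" using D0 by simp
  define w where "w x = f x * f x * p x" for x
  obtain W where w: "primitive_on 0 l w W"
    unfolding w_def[abs_def] using primitive_on_mult[OF primitive_on_mult[OF f f] p(1)] by blast
  have "AE x in lebesgue_on {0<..<l}. w x = (f x)\<^sup>2 * wderiv 0 l v x"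
    using pd by eventually_elim (simp add: w_def power2_eq_square)
  then have dW: "AE x in lebesgue_on {0<..<l}. wderiv 0 l (\<lambda>x. (f x)\<^sup>2 * wderiv 0 l v x) x = W x"
    by (rule primitive_on_wderiv[OF l w])
  have in_dom: "AE x in lebesgue_on {0<..<l}. x \<in> {0<..<l}"
    by (rule AE_I2) (simp add: space_restrict_space)
  have "AE x in lebesgue_on {0<..<l}. w x / (f x)\<^sup>2 = g x"
    using p(2) in_dom
  proof eventually_elim
    case (elim x)
    then show ?case using nz[of x] by (simp add: w_def power2_eq_square)
  qed
  with k have 1: "primitive_on 0 l v (\<lambda>x. w x / (f x)\<^sup>2)"
    by (rule primitive_on_cong_AE_Ioo)
  have "AE x in lebesgue_on {0<..<l}. - \<rho>\<^sup>2 * (f x)\<^sup>2 * v x = W x"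
    using dW eq in_dom
  proof eventually_elim
    case (elim x)
    then have nz': "f x \<noteq> 0" and "- (1 / (f x)\<^sup>2) * W x = \<rho>\<^sup>2 * v x"
      using nz[of x] by (auto simp: impedance_def)
    then have "W x = - (f x)\<^sup>2 * (\<rho>\<^sup>2 * v x)" by (simp add: field_simps) (metis minus_minus)
    then show ?case by simp
  qed
  with w have 2: "primitive_on 0 l w (\<lambda>x. - \<rho>\<^sup>2 * (f x)\<^sup>2 * v x)"
    by (rule primitive_on_cong_AE_Ioo)
  show ?thesis by (rule that[OF 1 2]) (simp add: w_def f0 p0)
qed

section \<open>Uniqueness for linear first-order systems\<close>

text \<open>The integral \<open>S\<close> of \<open>s\<close> satisfies
  \<open>S' \<le> M * S\<close>, so \<open>S x * exp (- M * x)\<close> is nonincreasing and starts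
  at 0. Hence \<open>S \<le> 0\<close>, and the bound leaves no room for a positive
  \<open>s\<close>.\<close>

lemma gronwall_zero:
  fixes s :: "real \<Rightarrow> real"
  assumes cont: "continuous_on {0..l} s" and nonneg: "\<And>x. x \<in> {0..l} \<Longrightarrow> 0 \<le> s x"
    and bound: "\<And>x. x \<in> {0..l} \<Longrightarrow> s x \<le> M * integral {0..x} s" and M: "0 \<le> M" and x: "x \<in> {0..l}"
  shows "s x = 0"
proof -
  define S where "S x = integral {0..x} s" for x
  have "S x * exp (- M * x) \<le> S 0 * exp (- M * 0)"
  proof (cases "x = 0")
    case False
    then have "0 < x" using x by simp
    then show ?thesis
    proof (rule DERIV_nonpos_imp_decreasing_open[OF less_imp_le])
      fix y assume y: "0 < y" "y < x"
      have "(S has_real_derivative s y) (at y within {0..l})"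
        unfolding S_def[abs_def] by (rule integral_has_real_derivative[OF cont]) (use x y in auto)
      moreover have "at y within {0..l} = at y" using x y by (intro at_within_Icc_at) auto
      ultimately have S: "(S has_real_derivative s y) (at y)" by simp
      have "((\<lambda>x. S x * exp (- M * x)) has_real_derivative (s y - M * S y) * exp (- M * y)) (at y)"
        by (auto intro!: derivative_eq_intros S simp: algebra_simps)
      moreover have "(s y - M * S y) * exp (- M * y) \<le> 0"
        using bound[of y] x y by (intro mult_nonpos_nonneg) (auto simp: S_def)
      ultimately show "\<exists>z. ((\<lambda>x. S x * exp (- M * x)) has_real_derivative z) (at y) \<and> z \<le> 0" by blast
    next
      have "continuous_on {0..x} s" using cont x by (auto intro: continuous_on_subset)
      then show "continuous_on {0..x} (\<lambda>x. S x * exp (- M * x))"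
        unfolding S_def[abs_def]
        by (intro continuous_intros indefinite_integral_continuous_1 integrable_continuous_real)
    qed
  qed simp
  then have "S x \<le> 0" by (simp add: S_def mult_le_0_iff)
  then have "M * S x \<le> 0" using M by (simp add: mult_nonneg_nonpos)
  then show ?thesis using bound[OF x] nonneg[OF x] by (simp add: S_def)
qed

text \<open>Each component of the difference is bounded by \<open>M\<close> times the integral of
  the norm of the other one, \<open>M\<close> being a common bound of both coefficients. The sum
  \<open>s\<close> of the two norms therefore meets the Gronwall hypothesis.\<close>

lemma linear_system_unique:
  assumes A: "continuous_on {0..l} A" and B: "continuous_on {0..l} B"
    and 1: "primitive_on 0 l u1 (\<lambda>x. A x * w1 x)" "primitive_on 0 l w1 (\<lambda>x. B x * u1 x)"
    and 2: "primitive_on 0 l u2 (\<lambda>x. A x * w2 x)" "primitive_on 0 l w2 (\<lambda>x. B x * u2 x)"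
    and init: "u1 0 = u2 0" "w1 0 = w2 0" and x: "x \<in> {0..l}"
  shows "u1 x = u2 x"
proof -
  define d where "d x = u1 x - u2 x" for x
  define r where "r x = w1 x - w2 x" for x
  define s where "s x = norm (d x) + norm (r x)" for x
  note cont = primitive_on_continuous[OF 1(1)] primitive_on_continuous[OF 1(2)]
    primitive_on_continuous[OF 2(1)] primitive_on_continuous[OF 2(2)]
  have cd: "continuous_on {0..l} d" and cr: "continuous_on {0..l} r"
    unfolding d_def[abs_def] r_def[abs_def] by (intro continuous_intros cont)+
  have cs: "continuous_on {0..l} s" unfolding s_def[abs_def] by (intro continuous_intros cd cr)
  have "bounded (A ` {0..l} \<union> B ` {0..l})"
    using A B by (simp add: compact_continuous_image compact_imp_bounded)
  then obtain M where M: "M > 0" "\<And>x. x \<in> {0..l} \<Longrightarrow> norm (A x) \<le> M" "\<And>x. x \<in> {0..l} \<Longrightarrow> norm (B x) \<le> M"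
    unfolding bounded_pos by auto
  \<comment> \<open>Stated generically because it is used twice, with the roles of the two
    components exchanged.\<close>
  have bnd: "norm (p1 y - p2 y) \<le> M * integral {0..y} (\<lambda>x. norm (z x))"
    if "primitive_on 0 l p1 (\<lambda>x. C x * q1 x)" "primitive_on 0 l p2 (\<lambda>x. C x * q2 x)" "p1 0 = p2 0" "y \<in> {0..l}"
      "continuous_on {0..l} z" "\<And>x. z x = q1 x - q2 x" "\<And>x. x \<in> {0..l} \<Longrightarrow> norm (C x) \<le> M"
    for p1 p2 C q1 q2 z y
  proof -
    have "p1 y - p1 0 = integral {0..y} (\<lambda>x. C x * q1 x)" "p2 y - p2 0 = integral {0..y} (\<lambda>x. C x * q2 x)"
      using that by (auto simp: primitive_on_def)
    moreover have "(\<lambda>x. C x * q1 x) integrable_on {0..y}" "(\<lambda>x. C x * q2 x) integrable_on {0..y}"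
      using primitive_on_integrable(2)[OF that(1)] primitive_on_integrable(2)[OF that(2)] that(4)
      by (auto elim: integrable_on_subinterval)
    moreover have "p1 y - p2 y = (p1 y - p1 0) - (p2 y - p2 0)" using that(3) by simp
    ultimately have "p1 y - p2 y = integral {0..y} (\<lambda>x. C x * q1 x - C x * q2 x)"
      and i: "(\<lambda>x. C x * q1 x - C x * q2 x) integrable_on {0..y}"
      by (simp_all only: integral_diff integrable_diff)
    then have "norm (p1 y - p2 y) \<le> integral {0..y} (\<lambda>x. M * norm (z x))"
    proof (simp only:, intro integral_norm_bound_integral)
      show "(\<lambda>x. M * norm (z x)) integrable_on {0..y}"
        using that(4,5) by (intro integrable_continuous_real continuous_intros) (auto intro: continuous_on_subset)
      show "norm (C x * q1 x - C x * q2 x) \<le> M * norm (z x)" if "x \<in> {0..y}" for x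
      proof -
        have "C x * q1 x - C x * q2 x = C x * z x" by (simp add: \<open>\<And>x. z x = q1 x - q2 x\<close> right_diff_distrib)
        then show ?thesis
          using that \<open>y \<in> {0..l}\<close> by (auto simp: norm_mult intro!: mult_right_mono \<open>\<And>x. x \<in> {0..l} \<Longrightarrow> norm (C x) \<le> M\<close>)
      qed
    qed
    then show ?thesis by simp
  qed
  have "s x = 0"
  proof (rule gronwall_zero[OF cs _ _ _ x])
    show "0 \<le> s y" for y by (simp add: s_def)
    show "s y \<le> M * integral {0..y} s" if y: "y \<in> {0..l}" for y
    proof -
      have "continuous_on {0..y} d" "continuous_on {0..y} r"
        using cd cr y by (auto intro: continuous_on_subset)
      then have "integral {0..y} s = integral {0..y} (\<lambda>x. norm (d x)) + integral {0..y} (\<lambda>x. norm (r x))"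
        unfolding s_def[abs_def] by (intro integral_add integrable_continuous_real continuous_intros)
      moreover have "norm (d y) \<le> M * integral {0..y} (\<lambda>x. norm (r x))"
        unfolding d_def[of y] by (rule bnd[OF 1(1) 2(1) init(1) y cr _ M(2)]) (auto simp: r_def)
      moreover have "norm (r y) \<le> M * integral {0..y} (\<lambda>x. norm (d x))"
        unfolding r_def[of y] by (rule bnd[OF 1(2) 2(2) init(2) y cd _ M(3)]) (auto simp: d_def)
      ultimately show ?thesis by (simp add: s_def distrib_left)
    qed
  qed (use M in simp)
  then have "norm (d x) = 0" using norm_ge_zero[of "d x"] norm_ge_zero[of "r x"] unfolding s_def by linarith
  then show ?thesis by (simp add: d_def)
qed

text \<open>Both \<open>(y/f, f D\<^sub>f y)\<close> and \<open>(v, f\<^sup>2 v')\<close> solve the first-order system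
  \<open>u' = w / f\<^sup>2\<close>, \<open>w' = - \<rho>\<^sup>2 f\<^sup>2 u\<close> with the same initial values.\<close>

lemma schroedinger_exp_eq_impedance_exp:
  assumes l: "0 < l" and f: "f \<in> W12 0 l" and fc: "continuous_on {0..l} f"
    and nz: "\<And>x. x \<in> {0..l} \<Longrightarrow> f x \<noteq> 0" and f0: "f 0 = 1"
    and y: "schroedinger_exp l f \<rho> y" and v: "impedance_exp l f \<rho> v" and x: "x \<in> {0..l}"
  shows "y x = f x * v x"
proof -
  obtain f' where f': "primitive_on 0 l f f'" using W12_primitive_continuous[OF l f fc] by blast
  obtain w1 where w1: "primitive_on 0 l (\<lambda>x. y x / f x) (\<lambda>x. w1 x / (f x)\<^sup>2)"
    "primitive_on 0 l w1 (\<lambda>x. - \<rho>\<^sup>2 * (f x)\<^sup>2 * (y x / f x))" "w1 0 = \<i> * \<rho>"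
    using schroedinger_exp_system[OF l f' nz f0 y] by blast
  obtain w2 where w2: "primitive_on 0 l v (\<lambda>x. w2 x / (f x)\<^sup>2)"
    "primitive_on 0 l w2 (\<lambda>x. - \<rho>\<^sup>2 * (f x)\<^sup>2 * v x)" "w2 0 = \<i> * \<rho>"
    using impedance_exp_system[OF l f' nz f0 v] by blast
  have "y x / f x = v x"
  proof (rule linear_system_unique[where A = "\<lambda>x. 1 / (f x)\<^sup>2" and B = "\<lambda>x. - \<rho>\<^sup>2 * (f x)\<^sup>2" and l = l])
    show "continuous_on {0..l} (\<lambda>x. 1 / (f x)\<^sup>2)" "continuous_on {0..l} (\<lambda>x. - \<rho>\<^sup>2 * (f x)\<^sup>2)"
      using fc nz by (auto intro!: continuous_intros)
    show "y 0 / f 0 = v 0" using f0 y v by (simp add: schroedinger_exp_def impedance_exp_def)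
    show "w1 0 = w2 0" using w1 w2 by simp
  qed (use w1 w2 x in simp_all)
  then show ?thesis using nz[OF x] by (simp add: field_simps)
qed

subsection \<open>Kernels\<close>

text \<open>The substitution \<open>s = exp t\<close> turns the moments into power moments; dividing by \<open>s\<close> first makes the
  moment of order \<open>0\<close> unnecessary.\<close>

lemma exp_moments_zero_imp_AE_zero:
  fixes D :: "real \<Rightarrow> complex"
  assumes D: "D absolutely_integrable_on {a..b}"
    and mom: "\<And>n::nat. 0 < n \<Longrightarrow> integral {a..b} (\<lambda>t. D t * of_real (exp (real n * t))) = 0"
  shows "AE t in lebesgue_on {a<..<b}. D t = 0"
proof (rule fundamental_lemma_calculus_of_variations[OF absolutely_integrable_locally_integrable[OF D]])
  fix c d \<phi> \<phi>' assume cd: "a < c" "c < d" "d < b" and ph: "bump_fun c d \<phi> \<phi>'"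
  have cph: "continuous_on S \<phi>" for S using bump_fun_continuous[OF ph] by blast
  have int: "(\<lambda>t. D t * of_real (h t)) integrable_on {a..b}" if "continuous_on {a..b} h" for h :: "real \<Rightarrow> real"
  proof -
    have "(\<lambda>t. of_real (h t) * D t) absolutely_integrable_on {a..b}"
      by (rule absolutely_integrable_continuous_mult[OF _ D]) (intro continuous_intros that)
    then show ?thesis using set_lebesgue_integral_eq_integral(1) by (simp add: mult.commute)
  qed
  have Dn: "(\<lambda>t. norm (D t)) integrable_on {a..b}" using D by (simp add: absolutely_integrable_on_def)
  define I where "I = integral {a..b} (\<lambda>t. norm (D t))"
  have I0: "0 \<le> I" unfolding I_def by (rule integral_nonneg[OF Dn]) simp
  have "norm (integral {a..b} (\<lambda>t. D t * of_real (\<phi> t))) \<le> 0"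
  proof (rule field_le_epsilon)
    fix \<epsilon> :: real assume eps: "0 < \<epsilon>"
    \<comment> \<open>Multiplying back by \<open>exp t\<close> enlarges the approximation error to
      at most \<open>exp b * \<delta>\<close>, and integrating against \<open>norm (D t)\<close>
      brings in \<open>I\<close>. The \<open>+ 1\<close> covers the case
      \<open>I = 0\<close>.\<close>
    define \<delta> where "\<delta> = \<epsilon> / (exp b * (I + 1))"
    have delta: "0 < \<delta>" using eps I0 by (simp add: \<delta>_def)
    have cont: "continuous_on {exp a..exp b} (\<lambda>s. \<phi> (ln s) / s)"
    proof -
      have nz: "s \<noteq> 0" if "s \<in> {exp a..exp b}" for s
        using that exp_gt_zero[of a] by (metis atLeastAtMost_iff not_less)
      then have "continuous_on {exp a..exp b} (\<lambda>s. \<phi> (ln s))"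
        by (intro continuous_on_compose2[OF cph[of UNIV]] continuous_intros) auto
      then show ?thesis using nz by (intro continuous_on_divide continuous_intros) auto
    qed
    obtain p where p: "real_polynomial_function p" "\<And>s. s \<in> {exp a..exp b} \<Longrightarrow> \<bar>\<phi> (ln s) / s - p s\<bar> < \<delta>"
      using Stone_Weierstrass_real_polynomial_function[OF compact_Icc cont delta] by blast
    obtain \<alpha> n where pe: "p = (\<lambda>s. \<Sum>i\<le>(n::nat). \<alpha> i * s ^ i)"
      using p(1) real_polynomial_function_iff_sum by blast
    \<comment> \<open>Multiplication by \<open>exp t\<close> undoes the division by
      \<open>s\<close>; it shifts all exponents up by one, so only moments of order
      \<open>Suc i\<close> occur.\<close>
    define P where "P t = exp t * p (exp t)" for t :: real
    have P_sum: "P t = (\<Sum>i\<le>n. \<alpha> i * exp (real (Suc i) * t))" for t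
      unfolding P_def pe sum_distrib_left
      by (rule sum.cong) (auto simp: exp_add ring_distribs exp_of_nat_mult)
    have cP: "continuous_on {a..b} P" unfolding P_sum[abs_def] by (intro continuous_intros)
    have close: "\<bar>\<phi> t - P t\<bar> \<le> \<delta> * exp b" if t: "t \<in> {a..b}" for t
    proof -
      have "\<bar>\<phi> t / exp t - p (exp t)\<bar> < \<delta>" using p(2)[of "exp t"] t by simp
      moreover have "\<phi> t - P t = exp t * (\<phi> t / exp t - p (exp t))" by (simp add: P_def field_simps)
      ultimately have "\<bar>\<phi> t - P t\<bar> \<le> exp t * \<delta>" by (simp add: abs_mult)
      also have "\<dots> \<le> exp b * \<delta>" using t delta by (intro mult_right_mono) auto
      finally show ?thesis by (simp add: mult.commute)
    qed
    have "integral {a..b} (\<lambda>t. D t * of_real (P t)) =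
      integral {a..b} (\<lambda>t. \<Sum>i\<le>n. of_real (\<alpha> i) * (D t * of_real (exp (real (Suc i) * t))))"
      by (rule integral_cong) (simp only: P_sum of_real_sum of_real_mult sum_distrib_left mult.left_commute)
    also have "\<dots> = (\<Sum>i\<le>n. integral {a..b} (\<lambda>t. of_real (\<alpha> i) * (D t * of_real (exp (real (Suc i) * t)))))"
      by (rule integral_sum) (auto intro!: integrable_on_mult_right int continuous_intros simp del: of_nat_Suc)
    also have "\<dots> = 0" using mom by (simp del: of_nat_Suc)
    finally have "integral {a..b} (\<lambda>t. D t * of_real (\<phi> t)) =
      integral {a..b} (\<lambda>t. D t * of_real (\<phi> t)) - integral {a..b} (\<lambda>t. D t * of_real (P t))" by simp
    also have "\<dots> = integral {a..b} (\<lambda>t. D t * of_real (\<phi> t - P t))"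
      by (subst integral_diff[symmetric]) (auto intro!: int cph cP simp: right_diff_distrib)
    also have "norm \<dots> \<le> integral {a..b} (\<lambda>t. (\<delta> * exp b) * norm (D t))"
    proof (rule integral_norm_bound_integral)
      show "norm (D t * of_real (\<phi> t - P t)) \<le> (\<delta> * exp b) * norm (D t)" if "t \<in> {a..b}" for t
        using close[OF that] unfolding norm_mult norm_of_real by (subst mult.commute) (rule mult_right_mono, auto)
    qed (auto intro!: int cph cP continuous_intros integrable_on_mult_right Dn simp del: of_real_diff)
    also have "\<dots> = \<delta> * exp b * I" by (simp add: I_def)
    also have "\<dots> = \<epsilon> * (I / (I + 1))" by (simp add: \<delta>_def)
    also have "\<dots> \<le> \<epsilon> * 1" using I0 eps by (intro mult_left_mono) auto
    finally show "norm (integral {a..b} (\<lambda>t. D t * of_real (\<phi> t))) \<le> 0 + \<epsilon>" by simp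
  qed
  moreover have "integral {a..b} (\<lambda>t. D t * of_real (\<phi> t)) = integral {c..d} (\<lambda>t. D t * of_real (\<phi> t))"
    by (rule integral_compact_support) (use ph cd in \<open>auto simp: bump_fun_def\<close>)
  ultimately show "integral {c..d} (\<lambda>t. D t * of_real (\<phi> t)) = 0" by simp
qed

lemma primitive_on_exp:
  "primitive_on a b (\<lambda>t. exp (z * of_real t)) (\<lambda>t. z * exp (z * of_real t))"
proof (rule primitive_on_C1)
  show "((\<lambda>t. exp (z * of_real t)) has_vector_derivative z * exp (z * of_real x)) (at x within {a..b})" for x
  proof -
    have "((\<lambda>w. exp (z * w)) has_field_derivative z * exp (z * of_real x)) (at (of_real x))"
      by (auto intro!: derivative_eq_intros)
    then have "((\<lambda>t. exp (z * of_real t)) has_vector_derivative z * exp (z * of_real x)) (at x)"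
      by (rule has_vector_derivative_real_field)
    then show ?thesis by (rule has_vector_derivative_at_within)
  qed
qed (intro continuous_intros)

text \<open>Everything here concerns one fixed \<open>x\<close>: \<open>k\<close>, \<open>kh\<close>
  and \<open>F\<close> stand for \<open>K x\<close>, \<open>K_hat x\<close> and \<open>f x\<close>.
  The boundary value \<open>H x\<close> matches precisely the difference of the two free
  exponentials after division by \<open>F\<close>, so only integrals of \<open>H\<close> and
  \<open>kh\<close> remain.\<close>

lemma impedance_kernel_eq_primitive:
  fixes k kh :: "real \<Rightarrow> complex"
  assumes x: "0 < x" and k: "k absolutely_integrable_on {-x..x}" and kh: "kh absolutely_integrable_on {-x..x}"
    and F: "F \<noteq> 0"
    and eq: "\<And>\<rho>. exp (\<i> * \<rho> * of_real x) + (LINT t|lebesgue_on {-x<..<x}. k t * exp (\<i> * \<rho> * of_real t)) =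
      F * (exp (\<i> * \<rho> * of_real x) - \<i> * \<rho> * (LINT t|lebesgue_on {-x<..<x}. kh t * exp (\<i> * \<rho> * of_real t)))"
  obtains H where "primitive_on (-x) x H (\<lambda>t. 1 / F * k t)" "H (-x) = 0" "H x = 1 - 1 / F"
    "AE t in lebesgue_on {-x<..<x}. H t = kh t"
proof -
  define H where "H t = 0 + integral {-x..t} (\<lambda>t. 1 / F * k t)" for t
  have "(\<lambda>t. 1 / F * k t) absolutely_integrable_on {-x..x}"
    using k by (rule set_integrable_mult_right)
  then have H: "primitive_on (-x) x H (\<lambda>t. 1 / F * k t)"
    unfolding H_def[abs_def] by (rule primitive_on_indefinite)
  have Hm: "H (-x) = 0" by (simp add: H_def)
  have iE: "(\<lambda>t. w t * exp (z * of_real t)) absolutely_integrable_on {-x..x}"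
    if "w absolutely_integrable_on {-x..x}" for w :: "real \<Rightarrow> complex" and z
  proof -
    have "(\<lambda>t. exp (z * of_real t) * w t) absolutely_integrable_on {-x..x}"
      by (rule absolutely_integrable_continuous_mult[OF _ that]) (intro continuous_intros)
    then show ?thesis by (simp add: mult.commute)
  qed
  have eq': "exp (\<i> * \<rho> * of_real x) + integral {-x..x} (\<lambda>t. k t * exp (\<i> * \<rho> * of_real t)) =
      F * (exp (\<i> * \<rho> * of_real x) - \<i> * \<rho> * integral {-x..x} (\<lambda>t. kh t * exp (\<i> * \<rho> * of_real t)))" for \<rho>
    using eq[of \<rho>] LINT_eq_integral_Icc[OF iE[OF k]] LINT_eq_integral_Icc[OF iE[OF kh]] by simp
  have "H x = 1 / F * integral {-x..x} k" by (simp add: H_def)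
  also have "integral {-x..x} k = F - 1" using eq'[of 0] by (simp add: algebra_simps)
  finally have Hx: "H x = 1 - 1 / F" using F by (simp add: field_simps)
  have cH: "H absolutely_integrable_on {-x..x}"
    using primitive_on_continuous[OF H] absolutely_integrable_continuous_real by blast
  have moment: "integral {-x..x} (\<lambda>t. (H t - kh t) * exp (\<i> * \<rho> * of_real t)) = 0" if rho: "\<rho> \<noteq> 0" for \<rho>
  proof -
    define E where "E t = exp (\<i> * \<rho> * of_real t)" for t
    have E: "primitive_on (-x) x E (\<lambda>t. \<i> * \<rho> * E t)"
      unfolding E_def[abs_def] by (rule primitive_on_exp)
    have iH: "(\<lambda>t. H t * E t) integrable_on {-x..x}" and ikh: "(\<lambda>t. kh t * E t) integrable_on {-x..x}"
      and ik: "(\<lambda>t. k t * E t) integrable_on {-x..x}"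
      unfolding E_def using iE[OF cH] iE[OF kh] iE[OF k] set_lebesgue_integral_eq_integral(1) by blast+
    have "H x * E x - H (-x) * E (-x) = integral {-x..x} (\<lambda>t. H t * (\<i> * \<rho> * E t) + E t * (1 / F * k t))"
      using primitive_on_diff[OF primitive_on_mult[OF H E], of "-x" x] x by simp
    also have "\<dots> = integral {-x..x} (\<lambda>t. \<i> * \<rho> * (H t * E t) + 1 / F * (k t * E t))"
      by (simp add: mult_ac)
    also have "\<dots> = \<i> * \<rho> * integral {-x..x} (\<lambda>t. H t * E t) + 1 / F * integral {-x..x} (\<lambda>t. k t * E t)"
      by (subst integral_add) (simp_all only: integral_mult_right integrable_on_mult_right iH ik)
    finally have 1: "(1 - 1 / F) * E x = \<i> * \<rho> * integral {-x..x} (\<lambda>t. H t * E t) + 1 / F * integral {-x..x} (\<lambda>t. k t * E t)"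
      by (simp add: Hm Hx)
    have "E x + integral {-x..x} (\<lambda>t. k t * E t) = F * (E x - \<i> * \<rho> * integral {-x..x} (\<lambda>t. kh t * E t))"
      using eq'[of \<rho>] by (simp add: E_def)
    then have "1 / F * integral {-x..x} (\<lambda>t. k t * E t) = E x - \<i> * \<rho> * integral {-x..x} (\<lambda>t. kh t * E t) - 1 / F * E x"
      using F by (simp add: field_simps)
    then have "\<i> * \<rho> * integral {-x..x} (\<lambda>t. kh t * E t) =
        (1 - 1 / F) * E x - 1 / F * integral {-x..x} (\<lambda>t. k t * E t)"
      by (simp only: left_diff_distrib mult_1) simp
    also have "\<dots> = \<i> * \<rho> * integral {-x..x} (\<lambda>t. H t * E t)"
      using 1 by simp
    finally have "\<i> * \<rho> * (integral {-x..x} (\<lambda>t. H t * E t) - integral {-x..x} (\<lambda>t. kh t * E t)) = 0"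
      by (simp only: right_diff_distrib) simp
    \<comment> \<open>Cancelling \<open>\<i> * \<rho>\<close> is what restricts the argument to
      nonzero \<open>\<rho>\<close>.\<close>
    then have "integral {-x..x} (\<lambda>t. H t * E t) - integral {-x..x} (\<lambda>t. kh t * E t) = 0"
      using rho by simp
    then show ?thesis
      by (simp add: E_def[symmetric] left_diff_distrib integral_diff[OF iH ikh])
  qed
  have "AE t in lebesgue_on {-x<..<x}. H t - kh t = 0"
  proof (rule exp_moments_zero_imp_AE_zero)
    show "(\<lambda>t. H t - kh t) absolutely_integrable_on {-x..x}" using cH kh by (rule set_integral_diff(1))
    fix n :: nat assume n: "0 < n"
    \<comment> \<open>An imaginary spectral parameter turns the oscillating exponentials into real
      ones, to which polynomial approximation applies.\<close>
    have "\<i> * (- \<i> * of_nat n) * of_real t = of_real (real n * t)" for t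
      by (simp add: mult.assoc[symmetric])
    then show "integral {-x..x} (\<lambda>t. (H t - kh t) * of_real (exp (real n * t))) = 0"
      using moment[of "- \<i> * of_nat n"] n by (simp only: exp_of_real) simp
  qed
  then have "AE t in lebesgue_on {-x<..<x}. H t = kh t" by simp
  then show ?thesis using that[OF H Hm Hx] by blast
qed

section \<open>Weak partial derivatives on the triangle\<close>

text \<open>Tonelli is stated for the product sigma-algebra of Borel type, so the Lebesgue set is
  first split into a Borel part \<open>S\<close> and a part inside a null set. Sections of
  \<open>S\<close> are contained in sections of \<open>A\<close> and so have measure zero.\<close>

lemma negligible_of_negligible_sections:
  fixes A :: "(real \<times> real) set"
  assumes A: "A \<in> sets lebesgue" and sect: "\<And>x. negligible {t. (x, t) \<in> A}"
  shows "negligible A"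
proof -
  obtain S N N' where SN: "A = S \<union> N" "N \<subseteq> N'" "N' \<in> null_sets lborel" "S \<in> sets lborel"
    using A by (rule sets_completionE)
  have S: "S \<in> sets (lborel \<Otimes>\<^sub>M lborel)" using SN(4) by (simp only: lborel_prod)
  have zero: "emeasure lborel (Pair x -` S) = 0" for x
  proof -
    have m: "Pair x -` S \<in> sets lborel" using sets_Pair1[OF S] by simp
    have "Pair x -` S \<subseteq> {t. (x, t) \<in> A}" using SN(1) by auto
    then have "negligible (Pair x -` S)" using sect negligible_subset by blast
    then have "emeasure lebesgue (Pair x -` S) = 0" by (simp add: negligible_iff_null_sets null_setsD1)
    then show ?thesis using m by simp
  qed
  have "emeasure lborel S = emeasure (lborel \<Otimes>\<^sub>M lborel) S" by (simp add: lborel_prod)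
  also have "\<dots> = (\<integral>\<^sup>+ x. emeasure lborel (Pair x -` S) \<partial>lborel)"
    by (rule lborel.emeasure_pair_measure_alt[OF S])
  also have "\<dots> = 0" by (simp add: zero)
  finally have "S \<in> null_sets lborel" using SN(4) by (auto intro: null_setsI)
  then have "negligible S" "negligible N'"
    using SN(3) by (auto simp: negligible_iff_null_sets intro: null_sets_completionI)
  then show ?thesis using SN(1,2) by (metis negligible_Un negligible_subset)
qed

lemma sets_tri_dom: "tri_dom l \<in> sets lebesgue"
proof -
  have "closed {z :: real \<times> real. 0 \<le> fst z \<and> fst z \<le> l \<and> \<bar>snd z\<bar> \<le> fst z}"
    by (intro closed_Collect_conj closed_Collect_le continuous_intros)
  moreover have "tri_dom l = {z. 0 \<le> fst z \<and> fst z \<le> l \<and> \<bar>snd z\<bar> \<le> fst z}"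
    by (auto simp: tri_dom_def)
  ultimately show ?thesis by (simp add: borel_closed sets_completionI_sets)
qed

text \<open>For each fixed \<open>x\<close>, uniqueness of weak derivatives makes the section of the
  exceptional set null. Joint measurability of both versions makes the whole set measurable, so that
  null sections suffice.\<close>

lemma has_weak_dt_unique:
  assumes G: "has_weak_dt l K G" and G': "has_weak_dt l K G'"
  shows "AE (x, t) in lebesgue_on (tri_dom l). G x t = G' x t"
proof -
  \<comment> \<open>The definition of \<open>has_weak_dt\<close> says nothing at
    \<open>x = 0\<close>; there the triangle consists of the single point \<open>(0, 0)\<close>,
    which is added at the end.\<close>
  define A where "A = {z \<in> tri_dom l. case_prod G z \<noteq> case_prod G' z \<and> 0 < fst z}"
  have "A \<in> sets lebesgue"
  proof -
    have "case_prod G \<in> borel_measurable (lebesgue_on (tri_dom l))" "case_prod G' \<in> borel_measurable (lebesgue_on (tri_dom l))"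
      using G G' by (auto simp: has_weak_dt_def)
    then have "{z \<in> space (lebesgue_on (tri_dom l)). case_prod G z \<noteq> case_prod G' z} \<in> sets (lebesgue_on (tri_dom l))"
      by measurable
    then have "{z \<in> tri_dom l. case_prod G z \<noteq> case_prod G' z} \<in> sets lebesgue"
      using sets_tri_dom[of l] by (auto simp: sets_restrict_space_iff space_restrict_space)
    moreover have "open {z :: real \<times> real. 0 < fst z}"
      by (intro open_Collect_less continuous_intros)
    then have "{z :: real \<times> real. 0 < fst z} \<in> sets lebesgue" by (simp add: sets_completionI_sets)
    ultimately have "{z \<in> tri_dom l. case_prod G z \<noteq> case_prod G' z} \<inter> {z. 0 < fst z} \<in> sets lebesgue"
      by (rule sets.Int)
    moreover have "A = {z \<in> tri_dom l. case_prod G z \<noteq> case_prod G' z} \<inter> {z. 0 < fst z}"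
      by (auto simp: A_def)
    ultimately show ?thesis by simp
  qed
  moreover have "negligible {t. (x, t) \<in> A}" for x
  proof (cases "x \<in> {0<..l}")
    case True
    then have "AE t in lebesgue_on {-x<..<x}. G x t = G' x t"
      using G G' has_weak_deriv_unique unfolding has_weak_dt_def by blast
    then have "negligible ({t \<in> {-x<..<x}. G x t \<noteq> G' x t} \<union> {-x, x})"
      by (auto simp: AE_lebesgue_on_iff_negligible)
    then show ?thesis
      by (rule negligible_subset) (auto simp: A_def tri_dom_def)
  next
    case False
    then have "{t. (x, t) \<in> A} = {}" by (auto simp: A_def tri_dom_def)
    then show ?thesis by simp
  qed
  ultimately have "negligible (A \<union> {(0, 0)})"
    by (intro negligible_Un negligible_of_negligible_sections) auto
  then have "negligible {z \<in> tri_dom l. \<not> (case z of (x, t) \<Rightarrow> G x t = G' x t)}"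
    by (rule negligible_subset) (auto simp: A_def tri_dom_def)
  then show ?thesis by (simp add: AE_lebesgue_on_iff_negligible sets_tri_dom)
qed

lemma L2_cmult: "u \<in> L2 S \<Longrightarrow> (\<lambda>x. c * u x) \<in> L2 S"
  by (auto simp: L2_def norm_mult power_mult_distrib)

lemma AE_lebesgue_on_subset:
  assumes "AE x in lebesgue_on T. P x" "S \<subseteq> T" "S \<in> sets lebesgue" "T \<in> sets lebesgue"
  shows "AE x in lebesgue_on S. P x"
proof -
  have "negligible {x \<in> T. \<not> P x}" using assms by (simp add: AE_lebesgue_on_iff_negligible)
  then have "negligible {x \<in> S. \<not> P x}" by (rule negligible_subset) (use assms(2) in auto)
  then show ?thesis using assms(3) by (simp add: AE_lebesgue_on_iff_negligible)
qed

section \<open>The operator identity and the three claims\<close>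

text \<open>Integrating \<open>H * g\<close> by parts over \<open>{-x..x}\<close> leaves the
  boundary term \<open>(1 - 1 / F) * V x\<close> alone, as \<open>H\<close> vanishes at
  \<open>-x\<close>; subtracted from \<open>v x\<close> it leaves \<open>v x / F\<close>. Inside
  integrals \<open>v\<close> may be replaced by its continuous representative \<open>V\<close>, but
  the free term \<open>v x\<close> is a point value, whence the assumption
  \<open>V x = v x\<close>.\<close>

lemma T_hat_op_eq_T_op:
  assumes x: "0 < x" "x \<le> l" and k: "K x absolutely_integrable_on {-x..x}"
    and H: "primitive_on (-x) x H (\<lambda>t. 1 / F * K x t)" "H (-x) = 0" "H x = 1 - 1 / F"
    and HK: "AE t in lebesgue_on {-x<..<x}. H t = K_hat x t"
    and vg: "has_weak_deriv (-l) l v g" and V: "primitive_on (-l) l V g"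
    and Vv: "AE t in lebesgue_on {-l<..<l}. V t = v t" and at_x: "V x = v x"
  shows "T_hat_op l K_hat v x = 1 / F * T_op K v x"
proof -
  have V': "primitive_on (-x) x V g" by (rule primitive_on_subinterval[OF V]) (use x in auto)
  have sub: "{-x<..<x} \<subseteq> {-l<..<l}" using x by auto
  have Vv': "AE t in lebesgue_on {-x<..<x}. V t = v t"
    by (rule AE_lebesgue_on_subset[OF Vv sub]) auto
  have "AE t in lebesgue_on {-x<..<x}. wderiv (-l) l v t = g t"
    by (rule AE_lebesgue_on_subset[OF wderiv_works(2)[OF vg] sub]) auto
  with HK have "AE t in lebesgue_on {-x<..<x}. K_hat x t * wderiv (-l) l v t = H t * g t"
    by eventually_elim simp
  then have "(LINT t|lebesgue_on {-x<..<x}. K_hat x t * wderiv (-l) l v t) = (LINT t|lebesgue_on {-x<..<x}. H t * g t)"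
    by (intro LINT_cong_AE_lebesgue_on) auto
  also have iHg: "(\<lambda>t. H t * g t) absolutely_integrable_on {-x..x}"
    using primitive_on_continuous[OF H(1)] primitive_on_integrable(1)[OF V'] by (rule absolutely_integrable_continuous_mult)
  then have "(LINT t|lebesgue_on {-x<..<x}. H t * g t) = integral {-x..x} (\<lambda>t. H t * g t)"
    by (rule LINT_eq_integral_Icc)
  finally have 1: "(LINT t|lebesgue_on {-x<..<x}. K_hat x t * wderiv (-l) l v t) = integral {-x..x} (\<lambda>t. H t * g t)" .
  have "AE t in lebesgue_on {-x<..<x}. K x t * v t = V t * K x t"
    using Vv' by eventually_elim simp
  then have "(LINT t|lebesgue_on {-x<..<x}. K x t * v t) = (LINT t|lebesgue_on {-x<..<x}. V t * K x t)"
    by (intro LINT_cong_AE_lebesgue_on) auto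
  also have iVK: "(\<lambda>t. V t * K x t) absolutely_integrable_on {-x..x}"
    using primitive_on_continuous[OF V'] k by (rule absolutely_integrable_continuous_mult)
  then have "(LINT t|lebesgue_on {-x<..<x}. V t * K x t) = integral {-x..x} (\<lambda>t. V t * K x t)"
    by (rule LINT_eq_integral_Icc)
  finally have 2: "(LINT t|lebesgue_on {-x<..<x}. K x t * v t) = integral {-x..x} (\<lambda>t. V t * K x t)" .
  have "(1 - 1 / F) * V x = integral {-x..x} (\<lambda>t. H t * g t + V t * (1 / F * K x t))"
    using primitive_on_diff[OF primitive_on_mult[OF H(1) V'], of "-x" x] x H(2,3) by simp
  also have "\<dots> = integral {-x..x} (\<lambda>t. H t * g t + 1 / F * (V t * K x t))" by (simp add: mult_ac)
  also have "\<dots> = integral {-x..x} (\<lambda>t. H t * g t) + 1 / F * integral {-x..x} (\<lambda>t. V t * K x t)"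
    using set_lebesgue_integral_eq_integral(1)[OF iHg] set_lebesgue_integral_eq_integral(1)[OF iVK]
    by (subst integral_add) (simp_all only: integral_mult_right integrable_on_mult_right)
  finally have "integral {-x..x} (\<lambda>t. H t * g t) = (1 - 1 / F) * v x - 1 / F * integral {-x..x} (\<lambda>t. V t * K x t)"
    by (simp only: at_x) simp
  then show ?thesis unfolding T_hat_op_def T_op_def 1 2 by (simp add: algebra_simps)
qed

theorem theorem46:
  fixes l :: real
    and f :: "real \<Rightarrow> complex"
    and e e_hat :: "complex \<Rightarrow> real \<Rightarrow> complex"
    and K K_hat :: "real \<Rightarrow> real \<Rightarrow> complex"
  assumes "l > 0"
    and "f \<in> W12 0 l" and "continuous_on {0..l} f"
    and "\<forall>x\<in>{0..l}. f x \<noteq> 0" and "f 0 = 1"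
    and "\<forall>\<rho>. schroedinger_exp l f \<rho> (e \<rho>)"
    and "schroedinger_kernel l e K"
    and "\<forall>\<rho>. impedance_exp l f \<rho> (e_hat \<rho>)"
    and "impedance_kernel l e_hat K_hat"
  shows
    "(\<forall>v\<in>W12 (-l) l.
        (AE x in lebesgue_on {0<..<l}. T_hat_op l K_hat v x = 1 / f x * T_op K v x) \<and>
        (continuous_on {-l..l} v \<longrightarrow>
           (\<forall>x\<in>{0..l}. T_hat_op l K_hat v x = 1 / f x * T_op K v x))) \<and>
     (\<forall>x\<in>{0<..l}. K_hat x \<in> W12 (-x) x) \<and>
     (\<exists>G. has_weak_dt l K_hat G) \<and>
     (\<forall>G. has_weak_dt l K_hat G \<longrightarrow>
        (AE (x, t) in lebesgue_on (tri_dom l). G x t = 1 / f x * K x t)) \<and>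
     (\<forall>x\<in>{0<..l}. cont_rep (-x) x (K_hat x) x = 1 - 1 / f x \<and>
        cont_rep (-x) x (K_hat x) (-x) = 0)"
proof -
  note l = assms(1)
  have nz: "f x \<noteq> 0" if "x \<in> {0..l}" for x using assms(4) that by blast
  have KL2: "K x \<in> L2 {-x<..<x}" and KhL2: "K_hat x \<in> L2 {-x<..<x}" if "x \<in> {0<..l}" for x
    using assms(7,9) that by (auto simp: schroedinger_kernel_def impedance_kernel_def L2_kernel_def)
  have "\<exists>H. primitive_on (-x) x H (\<lambda>t. 1 / f x * K x t) \<and> H (-x) = 0 \<and> H x = 1 - 1 / f x \<and>
    (AE t in lebesgue_on {-x<..<x}. H t = K_hat x t)" if x: "x \<in> {0<..l}" for x
  proof -
    have x': "0 < x" "x \<in> {0..l}" using x by auto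
    have eq: "exp (\<i> * \<rho> * of_real x) + (LINT t|lebesgue_on {-x<..<x}. K x t * exp (\<i> * \<rho> * of_real t)) =
      f x * (exp (\<i> * \<rho> * of_real x) - \<i> * \<rho> * (LINT t|lebesgue_on {-x<..<x}. K_hat x t * exp (\<i> * \<rho> * of_real t)))" for \<rho>
    proof -
      have "e \<rho> x = f x * e_hat \<rho> x"
        by (rule schroedinger_exp_eq_impedance_exp[OF l assms(2,3) nz assms(5) assms(6)[rule_format]
              assms(8)[rule_format] x'(2)])
      then show ?thesis using assms(7,9) x by (simp add: schroedinger_kernel_def impedance_kernel_def)
    qed
    show ?thesis
      by (rule impedance_kernel_eq_primitive[OF x'(1) L2_absolutely_integrable[OF KL2[OF x]]
          L2_absolutely_integrable[OF KhL2[OF x]] nz[OF x'(2)] eq]) blast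
  qed
  then have "\<forall>x\<in>{0<..l}. \<exists>H. primitive_on (-x) x H (\<lambda>t. 1 / f x * K x t) \<and> H (-x) = 0 \<and> H x = 1 - 1 / f x \<and>
    (AE t in lebesgue_on {-x<..<x}. H t = K_hat x t)" by blast
  from bchoice[OF this] obtain H where H': "\<forall>x\<in>{0<..l}. primitive_on (-x) x (H x) (\<lambda>t. 1 / f x * K x t) \<and>
    H x (-x) = 0 \<and> H x x = 1 - 1 / f x \<and> (AE t in lebesgue_on {-x<..<x}. H x t = K_hat x t)" ..
  have H: "primitive_on (-x) x (H x) (\<lambda>t. 1 / f x * K x t)" "H x (-x) = 0" "H x x = 1 - 1 / f x"
    "AE t in lebesgue_on {-x<..<x}. H x t = K_hat x t" if "x \<in> {0<..l}" for x
    using bspec[OF H' that] by auto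
  have weak: "has_weak_deriv (-x) x (K_hat x) (\<lambda>t. 1 / f x * K x t)" if x: "x \<in> {0<..l}" for x
    by (rule has_weak_deriv_cong_AE[OF primitive_on_has_weak_deriv[OF _ H(1)[OF x]] H(4)[OF x]]) (use x in auto)
  \<comment> \<open>This version is jointly measurable because \<open>K\<close> is and
    \<open>1 / f\<close> is continuous.\<close>
  have dt: "has_weak_dt l K_hat (\<lambda>x t. 1 / f x * K x t)"
    unfolding has_weak_dt_def
  proof (intro conjI ballI weak)
    have "continuous_on (tri_dom l) (\<lambda>z. 1 / f (fst z))"
      using nz by (intro continuous_intros continuous_on_compose2[OF assms(3)]) (auto simp: tri_dom_def)
    then have "(\<lambda>z. 1 / f (fst z)) \<in> borel_measurable (lebesgue_on (tri_dom l))"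
      by (rule continuous_imp_measurable_on_sets_lebesgue) (rule sets_tri_dom)
    moreover have "case_prod K \<in> borel_measurable (lebesgue_on (tri_dom l))"
      using assms(7) by (auto simp: schroedinger_kernel_def L2_kernel_def L2_def)
    ultimately have "(\<lambda>z. 1 / f (fst z) * case_prod K z) \<in> borel_measurable (lebesgue_on (tri_dom l))"
      by (rule borel_measurable_times)
    then show "(\<lambda>(x, t). 1 / f x * K x t) \<in> borel_measurable (lebesgue_on (tri_dom l))"
      by (simp add: case_prod_unfold)
  qed
  have W: "K_hat x \<in> W12 (-x) x" if x: "x \<in> {0<..l}" for x
    using KhL2[OF x] weak[OF x] L2_cmult[OF KL2[OF x], of "1 / f x"] by (auto simp: W12_def)
  have rep: "cont_rep (-x) x (K_hat x) x = 1 - 1 / f x \<and> cont_rep (-x) x (K_hat x) (-x) = 0"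
    if x: "x \<in> {0<..l}" for x
    using cont_rep_eq[OF _ primitive_on_continuous[OF H(1)[OF x]] H(4)[OF x]] H(2,3)[OF x] x by auto
  have T: "(AE x in lebesgue_on {0<..<l}. T_hat_op l K_hat v x = 1 / f x * T_op K v x) \<and>
        (continuous_on {-l..l} v \<longrightarrow> (\<forall>x\<in>{0..l}. T_hat_op l K_hat v x = 1 / f x * T_op K v x))"
    if v: "v \<in> W12 (-l) l" for v
  proof -
    have ll: "-l < l" using l by simp
    obtain V g where g: "has_weak_deriv (-l) l v g" and V: "primitive_on (-l) l V g"
      and Vv: "AE x in lebesgue_on {-l<..<l}. V x = v x"
      using W12_primitive[OF ll v] by metis
    have eq: "T_hat_op l K_hat v x = 1 / f x * T_op K v x" if "x \<in> {0<..l}" "V x = v x" for x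
      by (rule T_hat_op_eq_T_op[where K = K and H = "H x" and x = x and l = l and F = "f x" and K_hat = K_hat and v = v,
            OF _ _ L2_absolutely_integrable[OF KL2[OF that(1)]] H[OF that(1)] g V Vv that(2)])
        (use that(1) in auto)
    \<comment> \<open>An arbitrary representative \<open>v\<close> agrees with \<open>V\<close> only
      almost everywhere, so the pointwise identity holds just at those \<open>x\<close>; continuity
      of \<open>v\<close> removes the exception.\<close>
    have "AE x in lebesgue_on {0<..<l}. V x = v x"
      by (rule AE_lebesgue_on_subset[OF Vv]) (use l in auto)
    moreover have "AE x in lebesgue_on {0<..<l}. x \<in> {0<..<l}"
      by (rule AE_I2) (simp add: space_restrict_space)
    ultimately have ae: "AE x in lebesgue_on {0<..<l}. T_hat_op l K_hat v x = 1 / f x * T_op K v x"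
    proof eventually_elim
      case (elim x)
      then show ?case by (intro eq) auto
    qed
    have "T_hat_op l K_hat v x = 1 / f x * T_op K v x" if vc: "continuous_on {-l..l} v" and x: "x \<in> {0..l}" for x
    proof (cases "x = 0")
      \<comment> \<open>Both integrals run over an empty interval, and \<open>f 0 = 1\<close>
        equates the free terms.\<close>
      case True
      have "(LINT t|lebesgue_on {-x<..<x}. w t) = 0" for w :: "real \<Rightarrow> complex"
        using True LINT_eq_integral_Icc[where f = w and a = 0 and b = 0]
        by (simp add: absolutely_integrable_negligible)
      then show ?thesis using True assms(5) by (simp add: T_hat_op_def T_op_def)
    next
      case False
      have "V x = v x"
        by (rule continuous_AE_eq[OF ll primitive_on_continuous[OF V] vc Vv]) (use x in auto)
      then show ?thesis using eq x False by auto
    qed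
    with ae show ?thesis by blast
  qed
  \<comment> \<open>The claim about every version \<open>G\<close> of the partial derivative follows
    by comparing it with the explicit version from \<open>dt\<close>.\<close>
  show ?thesis
    using T W rep dt has_weak_dt_unique[OF _ dt] by blast
qed

end
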